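(* Assume that $\nabla^2J$ is invertible with $\|(\nabla^2J(z))^{-1}\|$ bounded uniformly in $z=(x_{0:T},u_{t:T-1})$. Let $z^0$ be any initial point, and assume (standing smoothness assumption) that $\nabla^2J$ is bounded and Lipschitz continuous on an open neighborhood of the level set $\{z: f_{\mathcal M}(z)\le f_{\mathcal M}(z^0)\}$. Let $(z^i)_i=(x^i_{0:T},u^i_{t:T-1})_i$ be defined by $z^{i+1}=z^i+\alpha_ip^i$, where $p^i$ is the output of the stagewise algorithm (described in the context, and assumed well defined at each iterate) applied at $z^i$, and where the step length $\alpha_i$ satisfies the Wolfe conditions for the merit function $f_{\mathcal M}$ at $z^i$ in direction $p^i$. Then the sequence $(z^i)_i$ is globally convergent to a stationary point of $J$: whatever the initial point $z^0$, it converges to a point $z^\star$ with $\nabla J(z^\star)=0$. Furthermore, when the iterate is sufficiently close to the solution $z^\star$, the sequence has quadratic convergence: there is a constant $C$ such that $\|z^{i+1}-z^\star\|\le C\|z^i-z^\star\|^2$ once $z^i$ is sufficiently close to $z^\star$.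
   Context: Setting. Let $T\ge 1$ and $0\le t\le T$ be integers and $\mu>0$. States $x_j\in\mathbb R^{n_x}$, controls $u_j\in\mathbb R^{n_u}$, measurements $y_j\in\mathbb{R}^{n_y}$. The maps $f_j:\mathbb R^{n_x}\times\mathbb R^{n_u}\to\mathbb R^{n_x}$ ($0\le j<T$), $h_j:\mathbb R^{n_x}\to\mathbb R^{n_y}$ ($1\le j\le t$), $\ell_j:\mathbb R^{n_x}\times\mathbb R^{n_u}\to\mathbb R$ ($0\le j<T$), $\ell_T:\mathbb R^{n_x}\to\mathbb R$ are $\mathcal C^2$. The matrices $P$, $Q_j$ ($1\le j\le T$), $R_j$ ($1\le j\le t$) are symmetric positive definite. The past controls $u_0,\dots,u_{t-1}$, the measurements $y_1,\dots,y_t$ and the prior $\hat x_0$ are given and fixed. Define the function of the variables $x_{0:T}=(x_0,\dots,x_T)$ and $u_{t:T-1}=(u_t,\dots,u_{T-1})$ \begin{align*} J(x_{0:T},u_{t:T-1}) &= \sum_{j=0}^{T-1}\ell_j(x_j,u_j)+\ell_T(x_T) - \tfrac1{2\mu}(x_0-\hat x_0)^TP^{-1}(x_0-\hat x_0)\\ &\quad - \tfrac1{2\mu}\sum_{j=1}^t (y_j-h_j(x_j))^TR_j^{-1}(y_j-h_j(x_j))\\ &\quad - \tfrac1{2\mu}\sum_{j=0}^{T-1}(x_{j+1}-f_j(x_j,u_j))^TQ_{j+1}^{-1}(x_{j+1}-f_j(x_j,u_j)). \end{align*} Merit function: $f_{\mathcal M}(x_{0:T},u_{t:T-1})=\frac12\sum_{j=0}^T\left\|\frac{\partial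 J}{\partial x_j}\right\|^2+\frac12\sum_{j=t}^{T-1}\left\|\frac{\partial J}{\partial u_j}\right\|^2$. Wolfe conditions (with fixed constants $0<c_1<c_2<1$, step length $\alpha_i>0$): $f_{\mathcal M}(z^i+\alpha_ip^i)\le f_{\mathcal M}(z^i)+c_1\alpha_i\nabla f_{\mathcal M}(z^i)^Tp^i$ and $\nabla f_{\mathcal M}(z^i+\alpha_ip^i)^Tp^i\ge c_2\nabla f_{\mathcal M}(z^i)^Tp^i$. Notation for the algorithm at an iterate $(x^i_{0:T},u^i_{t:T-1})$ (with $u^i_k=u_k$ for $k<t$); all derivatives are evaluated at this iterate. Superscripts denote derivatives: $f^x_k,f^u_k,h^x_k$ are Jacobian matrices; $\ell^x_k,\ell^u_k$ are gradient column vectors; $\ell^{xx}_k,\ell^{uu}_k,\ell^{xu}_k,\ell^{ux}_k=(\ell^{xu}_k)^T$ are blocks of the Hessian ($\ell_k^{ux}$ has size $n_u\times n_x$). Put $w^i_{k+1}=x^i_{k+1}-f_k(x^i_k,u^i_k)$ and $\gamma^i_k=y_k-h_k(x^i_k)$. For a vector $a$ and a vector-valued function $\phi$, $a^T\phi^{xx}=\sum_m a_m\phi_m^{xx}$ (weighted sum of the Hessians of the components), and similarly for $\phi^{xu},\phi^{uu}$. For $k<T$ define \begin{align*} \bar\ell^{xx}_k&=\ell^{xx}_k+\mu^{-1}{w^i_{k+1}}^TQ_{k+1}^{-1}f^{xx}_k+\mu^{-1}\mathbf 1_{1\le k\le t}\,{\gamma^i_k}^TR_k^{-1}h^{xx}_k,\\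 \bar\ell^{xu}_k&=(\bar\ell^{ux}_k)^T=\ell^{xu}_k+\mu^{-1}{w^i_{k+1}}^TQ_{k+1}^{-1}f^{xu}_k,\\ \bar\ell^{uu}_k&=\ell^{uu}_k+\mu^{-1}{w^i_{k+1}}^TQ_{k+1}^{-1}f^{uu}_k, \end{align*} where $\mathbf 1_{1\le k\le t}$ equals $1$ if $1\le k\le t$ and $0$ otherwise. Stagewise algorithm (input: the iterate; output: $p=(p_{x_0},\dots,p_{x_T},p_{u_t},\dots,p_{u_{T-1}})$). It is well defined at an iterate if all the matrices inverted below are invertible. (1) Estimation forward pass: $P_0=P$, $\hat\mu_0=\hat x_0-x_0^i$, and for $k=0,\dots,t-1$: \begin{align*} E_{k+1} &= P_k^{-1} + {f^x_k}^T Q_{k+1}^{-1} f^x_k - \mu\bar\ell^{xx}_k,\\ \bar P_{k+1} &= Q_{k+1} + f^x_k(P_k^{-1}-\mu\bar\ell^{xx}_k)^{-1}{f^x_k}^T,\\ K_{k+1} &= \bar P_{k+1}{h^x_{k+1}}^T(R_{k+1}+h^x_{k+1}\bar P_{k+1}{h^x_{k+1}}^T)^{-1},\\ P_{k+1} &= (I_{n_x}-K_{k+1}h^x_{k+1})\bar P_{k+1},\\ \hat\mu_{k+1} &= (I_{n_x}-K_{k+1}h^x_{k+1})(f^x_k\hat\mu_k-w^i_{k+1}) + K_{k+1}\gamma^i_{k+1} + \mu P_{k+1}Q_{k+1}^{-1}f^x_kE_{k+1}^{-1}(\bar\ell^{xx}_k\hat\mu_k+\ell^x_k). \end{align*} (2)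 Control backward pass: $V_T=\ell^{xx}_T$, $v_T=\ell^x_T$, and for $k=T-1,\dots,t$: \begin{align*} \Gamma_{k+1} &= I_{n_x} - \mu V_{k+1} Q_{k+1},\\ Q_{uu}^{(k)} &= \bar\ell^{uu}_k + {f^u_k}^T \Gamma_{k+1}^{-1} V_{k+1} f^u_k,\\ Q_{ux}^{(k)} &= \bar\ell^{ux}_k + {f^u_k}^T \Gamma_{k+1}^{-1} V_{k+1} f^x_k,\\ Q_{u}^{(k)} &= \ell^{u}_k + {f^u_k}^T \Gamma_{k+1}^{-1}(v_{k+1} - V_{k+1} w^i_{k+1}),\\ G_k &= -(Q_{uu}^{(k)})^{-1} Q_{ux}^{(k)},\qquad g_k = -(Q_{uu}^{(k)})^{-1} Q_u^{(k)},\\ V_k &= \bar\ell^{xx}_k + {f^x_k}^T \Gamma_{k+1}^{-1} V_{k+1} f^x_k + {Q_{ux}^{(k)}}^T G_k,\\ v_k &= \ell^x_k + {f^x_k}^T \Gamma_{k+1}^{-1}(v_{k+1} - V_{k+1} w^i_{k+1}) + {Q_{ux}^{(k)}}^T g_k. \end{align*} (3) Coupling: $p_{x_t}=(P_t^{-1}-\mu V_t)^{-1}(P_t^{-1}\hat\mu_t+\mu v_t)$. (4) Estimation backward pass: for $k=t-1,\dots,0$, $p_{x_k}=E_{k+1}^{-1}\left({f^x_k}^TQ_{k+1}^{-1}(w^i_{k+1}+p_{x_{k+1}})+P_k^{-1}\hat\mu_k+\mu\ell^x_k\right)$. (5) Control forward pass: for $k=t,\dots,T-1$, $p_{u_k}=G_kp_{x_k}+g_k$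 and $p_{x_{k+1}}=(I_{n_x}-\mu Q_{k+1}V_{k+1})^{-1}\left(f^x_kp_{x_k}+f^u_kp_{u_k}+\mu Q_{k+1}v_{k+1}-w^i_{k+1}\right)$.
   Formalization: Quadratic rate is stated for steps α_i=1, and for all iterates near z* if c1<1/2 and α_i=1 is eventually taken whenever it satisfies Wolfe (false for arbitrary Wolfe steps); for t=T, V_T also contains the term μ^{-1}γ_T^T R_T^{-1} h_T^{xx}, without which the claim fails. *)

theory Defs
  imports "HOL-Analysis.Analysis"
begin

section \<open>Gradients, Hessians, positive definiteness\<close>

definition grad :: "('a::real_inner \<Rightarrow> real) \<Rightarrow> 'a \<Rightarrow> 'a"
  where "grad f x = (THE D. GDERIV f x :> D)"

definition hess :: "(real^'n \<Rightarrow> real) \<Rightarrow> real^'n \<Rightarrow> real^'n^'n"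
  where "hess f x = jacobian (grad f) (at x)"

text \<open>For a scalar function of \<open>(x, u)\<close>: the block whose entry \<open>(i, j)\<close> is the second derivative
  with respect to \<open>x $ i\<close> and \<open>u $ j\<close>.\<close>

definition hess_xu :: "((real^'n) \<times> (real^'m) \<Rightarrow> real) \<Rightarrow> real^'n \<Rightarrow> real^'m \<Rightarrow> real^'m^'n"
  where "hess_xu f x u = jacobian (\<lambda>\<nu>. grad (\<lambda>\<xi>. f (\<xi>, \<nu>)) x) (at u)"

text \<open>Weighted sums of the Hessians of the components of a vector-valued function.\<close>

definition whess :: "real^'q \<Rightarrow> (real^'n \<Rightarrow> real^'q) \<Rightarrow> real^'n \<Rightarrow> real^'n^'n"
  where "whess a \<phi> x = (\<Sum>m\<in>UNIV. (a $ m) *\<^sub>R hess (\<lambda>\<xi>. \<phi> \<xi> $ m) x)"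

definition whess_xu ::
    "real^'q \<Rightarrow> ((real^'n) \<times> (real^'m) \<Rightarrow> real^'q) \<Rightarrow> real^'n \<Rightarrow> real^'m \<Rightarrow> real^'m^'n"
  where "whess_xu a \<phi> x u = (\<Sum>m\<in>UNIV. (a $ m) *\<^sub>R hess_xu (\<lambda>\<zeta>. \<phi> \<zeta> $ m) x u)"

definition C2 :: "('a::real_normed_vector \<Rightarrow> 'b::real_normed_vector) \<Rightarrow> bool"
  where "C2 f \<longleftrightarrow> (\<exists>(f' :: 'a \<Rightarrow> 'a \<Rightarrow>\<^sub>L 'b) (f'' :: 'a \<Rightarrow> 'a \<Rightarrow>\<^sub>L ('a \<Rightarrow>\<^sub>L 'b)).
      (\<forall>x. (f has_derivative blinfun_apply (f' x)) (at x)) \<and>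
      (\<forall>x. (f' has_derivative blinfun_apply (f'' x)) (at x)) \<and>
      continuous_on UNIV f'')"

definition sym_posdef :: "real^'n^'n \<Rightarrow> bool"
  where "sym_posdef A \<longleftrightarrow> transpose A = A \<and> (\<forall>x. x \<noteq> 0 \<longrightarrow> 0 < x \<bullet> (A *v x))"

definition wolfe :: "real \<Rightarrow> real \<Rightarrow> ('a::real_inner \<Rightarrow> real) \<Rightarrow> 'a \<Rightarrow> 'a \<Rightarrow> real \<Rightarrow> bool"
  where "wolfe c1 c2 F z p a \<longleftrightarrow>
      F (z + a *\<^sub>R p) \<le> F z + c1 * a * (grad F z \<bullet> p) \<and>
      grad F (z + a *\<^sub>R p) \<bullet> p \<ge> c2 * (grad F z \<bullet> p)"


section \<open>Problem data and objective\<close>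

text \<open>Components of families outside their index range (\<open>dyn\<close>, \<open>cost\<close>: \<open>k < hor\<close>;
  \<open>meas\<close>, \<open>mcov\<close>, \<open>yobs\<close>: \<open>1 \<le> k \<le> cur\<close>; \<open>qcov\<close>: \<open>1 \<le> k \<le> hor\<close>;
  \<open>upast\<close>: \<open>k < cur\<close>) are irrelevant.\<close>

record ('n::finite, 'm::finite, 'q::finite) ocp =
  hor    :: nat                                      \<comment> \<open>\<open>T\<close>\<close>
  cur    :: nat                                      \<comment> \<open>\<open>t\<close>\<close>
  mu     :: real
  dyn    :: "nat \<Rightarrow> (real^'n) \<times> (real^'m) \<Rightarrow> real^'n"  \<comment> \<open>\<open>f\<close>\<close>
  meas   :: "nat \<Rightarrow> real^'n \<Rightarrow> real^'q"               \<comment> \<open>\<open>h\<close>\<close>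
  cost   :: "nat \<Rightarrow> (real^'n) \<times> (real^'m) \<Rightarrow> real"    \<comment> \<open>stage costs\<close>
  tcost  :: "real^'n \<Rightarrow> real"                        \<comment> \<open>terminal cost\<close>
  pcov   :: "real^'n^'n"                             \<comment> \<open>\<open>P\<close>\<close>
  qcov   :: "nat \<Rightarrow> real^'n^'n"                      \<comment> \<open>\<open>Q\<close>\<close>
  mcov   :: "nat \<Rightarrow> real^'q^'q"                      \<comment> \<open>\<open>R\<close>\<close>
  xprior :: "real^'n"
  upast  :: "nat \<Rightarrow> real^'m"
  yobs   :: "nat \<Rightarrow> real^'q"

definition ocp_setting :: "('n::finite, 'm::finite, 'q::finite) ocp \<Rightarrow> bool"
  where "ocp_setting pb \<longleftrightarrow>
      1 \<le> hor pb \<and> cur pb \<le> hor pb \<and> 0 < mu pb \<and>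
      (\<forall>j<hor pb. C2 (dyn pb j)) \<and>
      (\<forall>j\<in>{1..cur pb}. C2 (meas pb j)) \<and>
      (\<forall>j<hor pb. C2 (cost pb j)) \<and>
      C2 (tcost pb) \<and>
      sym_posdef (pcov pb) \<and>
      (\<forall>j\<in>{1..hor pb}. sym_posdef (qcov pb j)) \<and>
      (\<forall>j\<in>{1..cur pb}. sym_posdef (mcov pb j))"

definition Jtraj :: "('n::finite, 'm::finite, 'q::finite) ocp \<Rightarrow>
    (nat \<Rightarrow> real^'n) \<Rightarrow> (nat \<Rightarrow> real^'m) \<Rightarrow> real"
  where "Jtraj pb X U =
      (\<Sum>j<hor pb. cost pb j (X j, U j)) + tcost pb (X (hor pb))
      - 1 / (2 * mu pb) * ((X 0 - xprior pb) \<bullet> (matrix_inv (pcov pb) *v (X 0 - xprior pb)))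
      - 1 / (2 * mu pb) * (\<Sum>j=1..cur pb. (yobs pb j - meas pb j (X j)) \<bullet>
          (matrix_inv (mcov pb j) *v (yobs pb j - meas pb j (X j))))
      - 1 / (2 * mu pb) * (\<Sum>j<hor pb. (X (j + 1) - dyn pb j (X j, U j)) \<bullet>
          (matrix_inv (qcov pb (j + 1)) *v (X (j + 1) - dyn pb j (X j, U j))))"

text \<open>The variables \<open>x\<^sub>0, \<dots>, x\<^sub>T\<close>, \<open>u\<^sub>t, \<dots>, u\<^sub>T\<^sub>-\<^sub>1\<close> are stacked into one vector of
  \<open>real^'N\<close>. The scalar variables are named by the elements of \<open>var_idx pb\<close> (\<open>Inl (k, i)\<close> is the
  component \<open>i\<close> of \<open>x\<^sub>k\<close>, \<open>Inr (k, i)\<close> the component \<open>i\<close> of \<open>u\<^sub>k\<close>), and \<open>e\<close> is any bijection of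
  \<open>var_idx pb\<close> onto the coordinates \<open>'N\<close>. So \<open>CARD('N)\<close> is the total number of variables, and
  the Euclidean structure of \<open>real^'N\<close> is that of the stacked vector.\<close>

definition var_idx :: "('n::finite, 'm::finite, 'q::finite) ocp \<Rightarrow> (nat \<times> 'n + nat \<times> 'm) set"
  where "var_idx pb = ({..hor pb} \<times> UNIV) <+> ({cur pb..<hor pb} \<times> UNIV)"

definition state :: "(nat \<times> 'n + nat \<times> 'm \<Rightarrow> 'N) \<Rightarrow> real^'N \<Rightarrow> nat \<Rightarrow> real^'n"
  where "state e z k = (\<chi> i. z $ e (Inl (k, i)))"

definition ctrl :: "('n::finite, 'm::finite, 'q::finite) ocp \<Rightarrow>
    (nat \<times> 'n + nat \<times> 'm \<Rightarrow> 'N) \<Rightarrow> real^'N \<Rightarrow> nat \<Rightarrow> real^'m"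
  where "ctrl pb e z k = (if k < cur pb then upast pb k else (\<chi> i. z $ e (Inr (k, i))))"

definition stack :: "('n::finite, 'm::finite, 'q::finite) ocp \<Rightarrow>
    (nat \<times> 'n + nat \<times> 'm \<Rightarrow> 'N) \<Rightarrow> (nat \<Rightarrow> real^'n) \<Rightarrow> (nat \<Rightarrow> real^'m) \<Rightarrow> real^'N"
  where "stack pb e X U = (\<chi> c. case inv_into (var_idx pb) e c of
      Inl (k, i) \<Rightarrow> X k $ i | Inr (k, i) \<Rightarrow> U k $ i)"

definition J :: "('n::finite, 'm::finite, 'q::finite) ocp \<Rightarrow>
    (nat \<times> 'n + nat \<times> 'm \<Rightarrow> 'N) \<Rightarrow> real^'N \<Rightarrow> real"
  where "J pb e z = Jtraj pb (state e z) (ctrl pb e z)"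

definition merit :: "('n::finite, 'm::finite, 'q::finite) ocp \<Rightarrow>
    (nat \<times> 'n + nat \<times> 'm \<Rightarrow> 'N) \<Rightarrow> real^'N \<Rightarrow> real"
  where "merit pb e z = (let X = state e z; U = ctrl pb e z in
      1/2 * (\<Sum>j\<le>hor pb. (norm (grad (\<lambda>\<xi>. Jtraj pb (X(j := \<xi>)) U) (X j)))\<^sup>2) +
      1/2 * (\<Sum>j\<in>{cur pb..<hor pb}. (norm (grad (\<lambda>\<nu>. Jtraj pb X (U(j := \<nu>))) (U j)))\<^sup>2))"


section \<open>Derivatives along an iterate\<close>

text \<open>From here on the problem data and the iterate \<open>(X, U)\<close>, with \<open>U k = upast pb k\<close> for
  \<open>k < cur pb\<close>, are fixed parameters.\<close>

context
  fixes pb :: "('n::finite, 'm::finite, 'q::finite) ocp"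
    and X :: "nat \<Rightarrow> real^'n"
    and U :: "nat \<Rightarrow> real^'m"
begin

definition fx :: "nat \<Rightarrow> real^'n^'n"
  where "fx k = jacobian (\<lambda>\<xi>. dyn pb k (\<xi>, U k)) (at (X k))"

definition fu :: "nat \<Rightarrow> real^'m^'n"
  where "fu k = jacobian (\<lambda>\<nu>. dyn pb k (X k, \<nu>)) (at (U k))"

definition hx :: "nat \<Rightarrow> real^'n^'q"
  where "hx k = jacobian (meas pb k) (at (X k))"

definition lx :: "nat \<Rightarrow> real^'n"
  where "lx k = (if k < hor pb then grad (\<lambda>\<xi>. cost pb k (\<xi>, U k)) (X k)
                 else grad (tcost pb) (X k))"

definition lu :: "nat \<Rightarrow> real^'m"
  where "lu k = grad (\<lambda>\<nu>. cost pb k (X k, \<nu>)) (U k)"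

text \<open>\<open>w k\<close> is meant for \<open>1 \<le> k \<le> hor pb\<close>, \<open>\<gamma> k\<close> for \<open>1 \<le> k \<le> cur pb\<close>.\<close>

definition w :: "nat \<Rightarrow> real^'n"
  where "w k = X k - dyn pb (k - 1) (X (k - 1), U (k - 1))"

definition \<gamma> :: "nat \<Rightarrow> real^'q"
  where "\<gamma> k = yobs pb k - meas pb k (X k)"

definition meas_curv :: "nat \<Rightarrow> real^'n^'n"
  where "meas_curv k = (if 1 \<le> k \<and> k \<le> cur pb
      then (1 / mu pb) *\<^sub>R whess (\<gamma> k v* matrix_inv (mcov pb k)) (meas pb k) (X k) else 0)"

definition lbar_xx :: "nat \<Rightarrow> real^'n^'n"
  where "lbar_xx k = hess (\<lambda>\<xi>. cost pb k (\<xi>, U k)) (X k)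
      + (1 / mu pb) *\<^sub>R
          whess (w (k + 1) v* matrix_inv (qcov pb (k + 1))) (\<lambda>\<xi>. dyn pb k (\<xi>, U k)) (X k)
      + meas_curv k"

definition lbar_xu :: "nat \<Rightarrow> real^'m^'n"
  where "lbar_xu k = hess_xu (cost pb k) (X k) (U k)
      + (1 / mu pb) *\<^sub>R
          whess_xu (w (k + 1) v* matrix_inv (qcov pb (k + 1))) (dyn pb k) (X k) (U k)"

definition lbar_ux :: "nat \<Rightarrow> real^'n^'m"
  where "lbar_ux k = transpose (lbar_xu k)"

definition lbar_uu :: "nat \<Rightarrow> real^'m^'m"
  where "lbar_uu k = hess (\<lambda>\<nu>. cost pb k (X k, \<nu>)) (U k)
      + (1 / mu pb) *\<^sub>R
          whess (w (k + 1) v* matrix_inv (qcov pb (k + 1))) (\<lambda>\<nu>. dyn pb k (X k, \<nu>)) (U k)"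


section \<open>Estimation forward pass\<close>

text \<open>\<open>Pbar_step k Pk\<close> and \<open>K_step k Pk\<close> are the predicted matrix and the gain with index \<open>k + 1\<close>,
  computed from \<open>Pk = P\<^sub>k\<close>.\<close>

definition Pbar_step :: "nat \<Rightarrow> real^'n^'n \<Rightarrow> real^'n^'n"
  where "Pbar_step k Pk = qcov pb (k + 1) +
      fx k ** matrix_inv (matrix_inv Pk - mu pb *\<^sub>R lbar_xx k) ** transpose (fx k)"

definition K_step :: "nat \<Rightarrow> real^'n^'n \<Rightarrow> real^'q^'n"
  where "K_step k Pk = Pbar_step k Pk ** transpose (hx (k + 1)) **
      matrix_inv (mcov pb (k + 1) + hx (k + 1) ** Pbar_step k Pk ** transpose (hx (k + 1)))"

primrec Pest :: "nat \<Rightarrow> real^'n^'n"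
  where
    "Pest 0 = pcov pb"
  | "Pest (Suc k) = (mat 1 - K_step k (Pest k) ** hx (k + 1)) ** Pbar_step k (Pest k)"

text \<open>\<open>Emat k\<close> is \<open>E\<^sub>k\<^sub>+\<^sub>1\<close>.\<close>

definition Emat :: "nat \<Rightarrow> real^'n^'n"
  where "Emat k = matrix_inv (Pest k)
      + transpose (fx k) ** matrix_inv (qcov pb (k + 1)) ** fx k - mu pb *\<^sub>R lbar_xx k"

primrec muhat :: "nat \<Rightarrow> real^'n"
  where
    "muhat 0 = xprior pb - X 0"
  | "muhat (Suc k) =
      (mat 1 - K_step k (Pest k) ** hx (k + 1)) *v (fx k *v muhat k - w (k + 1))
      + K_step k (Pest k) *v \<gamma> (k + 1)
      + mu pb *\<^sub>R ((Pest (Suc k) ** matrix_inv (qcov pb (k + 1)) ** fx k ** matrix_inv (Emat k))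
          *v (lbar_xx k *v muhat k + lx k))"


section \<open>Control backward pass\<close>

text \<open>In the following definitions \<open>V\<close>, \<open>v\<close> stand for \<open>V\<^sub>k\<^sub>+\<^sub>1\<close>, \<open>v\<^sub>k\<^sub>+\<^sub>1\<close>.\<close>

definition Gam :: "nat \<Rightarrow> real^'n^'n \<Rightarrow> real^'n^'n"
  where "Gam k V = mat 1 - mu pb *\<^sub>R (V ** qcov pb (k + 1))"

definition Quu :: "nat \<Rightarrow> real^'n^'n \<Rightarrow> real^'m^'m"
  where "Quu k V = lbar_uu k + transpose (fu k) ** matrix_inv (Gam k V) ** V ** fu k"

definition Qux :: "nat \<Rightarrow> real^'n^'n \<Rightarrow> real^'n^'m"
  where "Qux k V = lbar_ux k + transpose (fu k) ** matrix_inv (Gam k V) ** V ** fx k"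

definition Qu :: "nat \<Rightarrow> real^'n^'n \<Rightarrow> real^'n \<Rightarrow> real^'m"
  where "Qu k V v = lu k
      + (transpose (fu k) ** matrix_inv (Gam k V)) *v (v - V *v w (k + 1))"

definition Gfb :: "nat \<Rightarrow> real^'n^'n \<Rightarrow> real^'n^'m"
  where "Gfb k V = - (matrix_inv (Quu k V) ** Qux k V)"

definition gff :: "nat \<Rightarrow> real^'n^'n \<Rightarrow> real^'n \<Rightarrow> real^'m"
  where "gff k V v = - (matrix_inv (Quu k V) *v Qu k V v)"

text \<open>The terminal value of \<open>V\<close> is the Hessian of the terminal cost if \<open>cur pb < hor pb\<close>. If
  \<open>cur pb = hor pb\<close>, the terminal state is also measured, and then, as in \<open>lbar_xx\<close> for the other
  measured states, the second-order term of the measurement function belongs to it; without it the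
  computed direction is not the Newton direction of \<open>J\<close> unless \<open>meas_curv (hor pb) = 0\<close>.\<close>

function Vmat :: "nat \<Rightarrow> real^'n^'n"
  where "Vmat k =
     (if hor pb \<le> k then hess (tcost pb) (X (hor pb)) + meas_curv (hor pb)
      else let V = Vmat (Suc k) in
        lbar_xx k + transpose (fx k) ** matrix_inv (Gam k V) ** V ** fx k
        + transpose (Qux k V) ** Gfb k V)"
  by auto
termination by (relation "Wellfounded.measure (\<lambda>k. hor pb - k)") auto

function vvec :: "nat \<Rightarrow> real^'n"
  where "vvec k =
     (if hor pb \<le> k then lx (hor pb)
      else let V = Vmat (Suc k); v = vvec (Suc k) in
        lx k + (transpose (fx k) ** matrix_inv (Gam k V)) *v (v - V *v w (k + 1))
        + transpose (Qux k V) *v gff k V v)"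
  by auto
termination by (relation "Wellfounded.measure (\<lambda>k. hor pb - k)") auto

declare Vmat.simps [simp del] vvec.simps [simp del]


section \<open>Coupling and final passes\<close>

definition pxt :: "real^'n"
  where "pxt = matrix_inv (matrix_inv (Pest (cur pb)) - mu pb *\<^sub>R Vmat (cur pb)) *v
      (matrix_inv (Pest (cur pb)) *v muhat (cur pb) + mu pb *\<^sub>R vvec (cur pb))"

text \<open>\<open>px_est k\<close> is the direction in \<open>x\<^sub>k\<close> for \<open>k \<le> cur pb\<close>, \<open>px_ctl k\<close> that for \<open>k \<ge> cur pb\<close>.\<close>

function px_est :: "nat \<Rightarrow> real^'n"
  where "px_est k =
     (if cur pb \<le> k then pxt
      else matrix_inv (Emat k) *v
        ((transpose (fx k) ** matrix_inv (qcov pb (k + 1))) *v (w (k + 1) + px_est (Suc k))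
         + matrix_inv (Pest k) *v muhat k + mu pb *\<^sub>R lx k))"
  by auto
termination by (relation "Wellfounded.measure (\<lambda>k. cur pb - k)") auto

declare px_est.simps [simp del]

definition pu_of :: "nat \<Rightarrow> real^'n \<Rightarrow> real^'m"
  where "pu_of k px = Gfb k (Vmat (k + 1)) *v px + gff k (Vmat (k + 1)) (vvec (k + 1))"

primrec px_ctl :: "nat \<Rightarrow> real^'n"
  where
    "px_ctl 0 = pxt"
  | "px_ctl (Suc k) =
     (if Suc k \<le> cur pb then pxt
      else matrix_inv (mat 1 - mu pb *\<^sub>R (qcov pb (k + 1) ** Vmat (k + 1))) *v
        (fx k *v px_ctl k + fu k *v pu_of k (px_ctl k)
         + mu pb *\<^sub>R (qcov pb (k + 1) *v vvec (k + 1)) - w (k + 1)))"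

definition dir_x :: "nat \<Rightarrow> real^'n"
  where "dir_x k = (if k \<le> cur pb then px_est k else px_ctl k)"

definition dir_u :: "nat \<Rightarrow> real^'m"
  where "dir_u k = pu_of k (dir_x k)"

definition pass_well_defined :: bool
  where "pass_well_defined \<longleftrightarrow>
      (\<forall>k\<le>cur pb. invertible (Pest k)) \<and>
      (\<forall>k<cur pb. invertible (Emat k) \<and>
         invertible (matrix_inv (Pest k) - mu pb *\<^sub>R lbar_xx k) \<and>
         invertible (mcov pb (k + 1)
           + hx (k + 1) ** Pbar_step k (Pest k) ** transpose (hx (k + 1)))) \<and>
      (\<forall>k\<in>{cur pb..<hor pb}. invertible (Gam k (Vmat (k + 1))) \<and>
         invertible (Quu k (Vmat (k + 1))) \<and>
         invertible (mat 1 - mu pb *\<^sub>R (qcov pb (k + 1) ** Vmat (k + 1)))) \<and>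
      invertible (matrix_inv (Pest (cur pb)) - mu pb *\<^sub>R Vmat (cur pb))"

end

definition alg_well_defined :: "('n::finite, 'm::finite, 'q::finite) ocp \<Rightarrow>
    (nat \<times> 'n + nat \<times> 'm \<Rightarrow> 'N) \<Rightarrow> real^'N \<Rightarrow> bool"
  where "alg_well_defined pb e z = pass_well_defined pb (state e z) (ctrl pb e z)"

definition alg_dir :: "('n::finite, 'm::finite, 'q::finite) ocp \<Rightarrow>
    (nat \<times> 'n + nat \<times> 'm \<Rightarrow> 'N) \<Rightarrow> real^'N \<Rightarrow> real^'N"
  where "alg_dir pb e z =
      stack pb e (dir_x pb (state e z) (ctrl pb e z)) (dir_u pb (state e z) (ctrl pb e z))"

end

(*
Let g and H be the gradient and the Hessian of J, so that the merit function is |g|^2 / 2 with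
gradient H g. Along a Newton direction H p = - g the sufficient decrease condition reads
|g(z + a p)|^2 <= (1 - 2 c1 a) |g(z)|^2, hence c1 a |g| is bounded by the decrease of |g|; as |p| is
at most a multiple of |g|, the steps are summable and the iterates converge. In the limit the
curvature condition gives |g|^2 <= c2 |g|^2, so g vanishes there. Near the limit the usual Taylor
estimate gives quadratic convergence of unit steps, and shows that they eventually satisfy the
Wolfe conditions.

That the stagewise direction is a Newton direction is seen by testing H p + g with a variation of
the trajectory. For each stage the result is a difference of two consecutive pairings of the
variation with a multiplier: V p + v on the control horizon, and P^{-1} (p - m) / mu, where m is the
estimate, on the estimation horizon. The coupling equation says that the two multipliers agree at
the current time, so that the sum over the stages telescopes to zero.
*)
theory Submission
  imports Defs
begin

text \<open>\<open>J\<close> adds costs and subtracts quadratic penalties, so its Hessian has no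
  sign and a Newton step need not decrease or increase \<open>J\<close> itself. The squared gradient
  is used as merit function because its slope along a Newton direction is \<open>- |g|^2\<close>
  whatever the signature of the Hessian. For the same reason the matrices in the passes carry no
  positivity: apart from the given covariances, every inverse rests on well-definedness.

  Step lengths have no a priori lower bound. Convergence of the iterates is therefore obtained
  before stationarity; it makes consecutive Hessians asymptotically equal, and then the curvature
  condition can be compared with the Newton equation.

  The block Hessian is never assembled. Second derivatives are bilinear forms tested with vectors,
  and a matrix enters only through its action. Symmetry of these forms is essential on the control
  horizon, where the recursion uses the transpose of \<open>Qux\<close>.\<close>

lemma matrix_inv_cancel:
  fixes A :: "real^'n^'n"
  assumes "invertible A"
  shows "matrix_inv A ** A = mat 1" and "A ** matrix_inv A = mat 1"
proof -
  have "A ** matrix_inv A = mat 1 \<and> matrix_inv A ** A = mat 1"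
    unfolding matrix_inv_def by (rule someI_ex[OF assms[unfolded invertible_def]])
  then show "matrix_inv A ** A = mat 1" and "A ** matrix_inv A = mat 1" by blast+
qed

lemma matrix_inv_cancel_vector:
  fixes A :: "real^'n^'n"
  assumes "invertible A"
  shows "matrix_inv A *v (A *v x) = x" and "A *v (matrix_inv A *v x) = x"
  by (simp_all only: matrix_vector_mul_assoc matrix_inv_cancel[OF assms] matrix_vector_mul_lid)

text \<open>The norm of the matrix type is the Frobenius norm; Cauchy-Schwarz in each row makes it
  compatible with the Euclidean norm.\<close>

lemma norm_matrix_vector_mult_le:
  fixes A :: "real^'n^'m"
  shows "norm (A *v x) \<le> norm A * norm x"
proof -
  have "norm (A *v x) \<le> L2_set (\<lambda>i. norm (A $ i) * norm x) UNIV"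
    unfolding norm_vec_def[of "A *v x"]
    by (rule L2_set_mono) (simp_all add: matrix_vector_mul_component Cauchy_Schwarz_ineq2)
  also have "\<dots> = norm A * norm x"
    by (simp add: norm_vec_def[of A] L2_set_left_distrib)
  finally show ?thesis .
qed

section \<open>Damped Newton iterations\<close>

locale newton_field =
  fixes g :: "real^'n \<Rightarrow> real^'n" and H :: "real^'n \<Rightarrow> real^'n^'n" and K :: real
  assumes deriv: "\<And>x. (g has_derivative (\<lambda>h. H x *v h)) (at x)"
    and inv: "\<And>x. invertible (H x)"
    and inv_bound: "\<And>x. norm (matrix_inv (H x)) \<le> K"
begin

lemma norm_le_image: "norm v \<le> K * norm (H x *v v)"
proof -
  have "norm v \<le> norm (matrix_inv (H x)) * norm (H x *v v)"
    using norm_matrix_vector_mult_le[of "matrix_inv (H x)" "H x *v v"] inv[of x]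
    by (simp add: matrix_inv_cancel_vector)
  also have "\<dots> \<le> K * norm (H x *v v)"
    using inv_bound by (simp add: mult_right_mono)
  finally show ?thesis .
qed

lemma K_nonneg: "0 \<le> K"
  by (rule order_trans[OF norm_ge_zero inv_bound])

text \<open>On the segment the map \<open>w \<mapsto> g w - H x *v w\<close> has derivative
  \<open>H w - H x\<close>, of norm at most \<open>L * norm (y - x)\<close>. The mean value
  inequality then gives the bound without integration, with \<open>L\<close> in place of the sharp
  \<open>L / 2\<close>.\<close>

lemma remainder_bound:
  assumes lip: "L-lipschitz_on S H" and S: "convex S" "x \<in> S" "y \<in> S"
  shows "norm (g y - g x - H x *v (y - x)) \<le> L * (norm (y - x))\<^sup>2"
proof -
  let ?T = "closed_segment x y"
  have T: "?T \<subseteq> S" using S by (rule closed_segment_subset[rotated 2])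
  have "norm ((g y - H x *v y) - (g x - H x *v x)) \<le> (L * norm (y - x)) * norm (y - x)"
  proof (rule differentiable_bound[where S = ?T and f = "\<lambda>w. g w - H x *v w" and f' = "\<lambda>w h. H w *v h - H x *v h"])
    fix w assume w: "w \<in> ?T"
    show "((\<lambda>w. g w - H x *v w) has_derivative (\<lambda>h. H w *v h - H x *v h)) (at w within ?T)"
      by (intro has_derivative_diff has_derivative_at_withinI[OF deriv]
          bounded_linear_imp_has_derivative matrix_vector_mul_bounded_linear)
    have "norm (H w - H x) \<le> L * norm (w - x)"
      using lipschitz_onD[OF lip] T w S by (metis dist_norm subsetD)
    also have "\<dots> \<le> L * norm (y - x)"
      using segment_bound1[of w x y] w lipschitz_on_nonneg[OF lip]
      by (intro mult_left_mono) (auto simp: norm_minus_commute)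
    finally have le: "norm (H w - H x) \<le> L * norm (y - x)" .
    show "onorm (\<lambda>h. H w *v h - H x *v h) \<le> L * norm (y - x)"
    proof (rule onorm_le)
      fix h
      have "norm (H w *v h - H x *v h) \<le> norm (H w - H x) * norm h"
        using norm_matrix_vector_mult_le[of "H w - H x" h] by (simp add: matrix_vector_mult_diff_rdistrib)
      also have "\<dots> \<le> L * norm (y - x) * norm h"
        using le by (intro mult_right_mono) auto
      finally show "norm (H w *v h - H x *v h) \<le> L * norm (y - x) * norm h" .
    qed
  qed auto
  then show ?thesis
    by (simp add: matrix_vector_mult_diff_distrib algebra_simps power2_eq_square)
qed

end

locale newton_wolfe = newton_field g H K
  for g :: "real^'n \<Rightarrow> real^'n" and H K +
  fixes c1 c2 :: real and z p :: "nat \<Rightarrow> real^'n" and \<alpha> :: "nat \<Rightarrow> real" and N L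
  assumes params: "0 < c1" "c1 < c2" "c2 < 1"
    and newton: "\<And>i. H (z i) *v p i = - g (z i)"
    and step: "\<And>i. z (Suc i) = z i + \<alpha> i *\<^sub>R p i"
    and step_pos: "\<And>i. 0 < \<alpha> i"
    and armijo: "\<And>i. (norm (g (z (Suc i))))\<^sup>2 \<le> (norm (g (z i)))\<^sup>2 - 2 * c1 * \<alpha> i * (norm (g (z i)))\<^sup>2"
    and curvature: "\<And>i. g (z (Suc i)) \<bullet> (H (z (Suc i)) *v p i) \<ge> - c2 * (norm (g (z i)))\<^sup>2"
    and nbhd: "open N" "{x. norm (g x) \<le> norm (g (z 0))} \<subseteq> N" "L-lipschitz_on N H"
begin

lemma norm_dir: "norm (p i) \<le> K * norm (g (z i))"
  using norm_le_image[of "p i" "z i"] newton by simp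

lemma residual_decrease: "norm (g (z (Suc i))) \<le> (1 - c1 * \<alpha> i) * norm (g (z i))"
proof (cases "g (z i) = 0")
  case True
  then show ?thesis using armijo[of i] by simp
next
  case False
  let ?n = "norm (g (z i))"
  have pos: "0 < ?n\<^sup>2" using False by simp
  \<comment> \<open>The decrease condition itself bounds the step: its right-hand side dominates a
    square, so \<open>2 * c1 * \<alpha> i \<le> 1\<close>, and square roots can be taken in
    \<open>1 - 2 * s \<le> (1 - s)^2\<close> with \<open>s = c1 * \<alpha> i\<close>.\<close>
  have "0 \<le> ?n\<^sup>2 - 2 * c1 * \<alpha> i * ?n\<^sup>2"
    using armijo[of i] zero_le_power2 order_trans by blast
  then have "0 \<le> (1 - 2 * c1 * \<alpha> i) * ?n\<^sup>2" by (simp add: algebra_simps)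
  then have le1: "0 \<le> 1 - 2 * c1 * \<alpha> i" using pos by (simp add: zero_le_mult_iff)
  have "(norm (g (z (Suc i))))\<^sup>2 \<le> (1 - 2 * c1 * \<alpha> i) * ?n\<^sup>2"
    using armijo[of i] by (simp add: algebra_simps)
  also have "\<dots> \<le> (1 - c1 * \<alpha> i)\<^sup>2 * ?n\<^sup>2"
    using zero_le_power2[of "c1 * \<alpha> i"]
    by (intro mult_right_mono) (auto simp: power2_diff)
  finally have "(norm (g (z (Suc i))))\<^sup>2 \<le> ((1 - c1 * \<alpha> i) * ?n)\<^sup>2"
    by (simp add: power_mult_distrib)
  moreover have "0 \<le> c1 * \<alpha> i" using params step_pos[of i] by simp
  ultimately show ?thesis
    using le1 by - (rule power2_le_imp_le, auto)
qed

lemma residual_antimono: "norm (g (z (Suc i))) \<le> norm (g (z i))"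
proof -
  have "0 \<le> c1 * \<alpha> i * norm (g (z i))" using params step_pos[of i] by simp
  then show ?thesis using residual_decrease[of i] by (simp add: algebra_simps)
qed

lemma residual_le_initial: "norm (g (z i)) \<le> norm (g (z 0))"
  using lift_Suc_antimono_le[of "\<lambda>i. norm (g (z i))" 0 i] residual_antimono by simp

lemma step_bound: "norm (z (Suc i) - z i) \<le> K / c1 * (norm (g (z i)) - norm (g (z (Suc i))))"
proof -
  have "norm (z (Suc i) - z i) = \<alpha> i * norm (p i)"
    using step_pos[of i] by (simp add: step)
  also have "\<dots> \<le> \<alpha> i * (K * norm (g (z i)))"
    using step_pos[of i] norm_dir by (simp add: mult_left_mono)
  also have "\<dots> = K / c1 * (c1 * \<alpha> i * norm (g (z i)))" using params by simp
  also have "\<dots> \<le> K / c1 * (norm (g (z i)) - norm (g (z (Suc i))))"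
    using residual_decrease[of i] K_nonneg params
    by (intro mult_left_mono) (auto simp: algebra_simps)
  finally show ?thesis .
qed

section \<open>Convergence to a stationary point\<close>

text \<open>Some limit \<open>l\<close> of the decreasing residual norms is enough for the
  telescoping series of \<open>step_bound\<close>; that the residual tends to zero is not yet
  known.\<close>

lemma convergent_iterates: "convergent z"
proof -
  have mono: "monoseq (\<lambda>i. norm (g (z i)))"
    using residual_antimono monoseq_Suc by blast
  have "Bseq (\<lambda>i. norm (g (z i)))"
    using residual_le_initial by (intro BseqI'[of _ "norm (g (z 0))"]) auto
  then have "convergent (\<lambda>i. norm (g (z i)))"
    using mono Bseq_monoseq_convergent by blast
  then obtain l where l: "(\<lambda>i. norm (g (z i))) \<longlonglongrightarrow> l" by (auto simp: convergent_def)
  have "summable (\<lambda>i. norm (g (z i)) - norm (g (z (Suc i))))"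
    using telescope_summable'[OF l] .
  then have "summable (\<lambda>i. K / c1 * (norm (g (z i)) - norm (g (z (Suc i)))))"
    by (rule summable_mult)
  then have "summable (\<lambda>i. z (Suc i) - z i)"
    by (rule summable_comparison_test'[where N = 0]) (use step_bound in auto)
  then have "convergent (\<lambda>n. \<Sum>i<n. z (Suc i) - z i)"
    by (simp add: summable_iff_convergent)
  then have "convergent (\<lambda>n. z n - z 0)" by (simp add: sum_lessThan_telescope)
  then show ?thesis
    by (simp add: convergent_diff_const_right_iff)
qed

definition zs where "zs = lim z"

lemma lim_z: "z \<longlonglongrightarrow> zs"
  unfolding zs_def by (rule convergent_LIMSEQ_iff[THEN iffD1, OF convergent_iterates])

lemma lim_g: "(\<lambda>i. g (z i)) \<longlonglongrightarrow> g zs"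
  by (rule isCont_tendsto_compose[OF has_derivative_continuous[OF deriv] lim_z])

text \<open>The level set is closed, so it contains the limit. This is what makes \<open>H\<close>
  continuous at \<open>zs\<close>, since continuity of \<open>H\<close> is assumed on
  \<open>N\<close> only.\<close>

lemma zs_in_N: "zs \<in> N"
proof -
  have "norm (g zs) \<le> norm (g (z 0))"
    by (rule LIMSEQ_le_const2[OF tendsto_norm[OF lim_g]]) (simp add: residual_le_initial)
  then show ?thesis using nbhd(2) by blast
qed

lemma z_in_N: "z i \<in> N"
  using nbhd(2) residual_le_initial by blast

lemma lim_H: "(\<lambda>i. H (z i)) \<longlonglongrightarrow> H zs"
  by (rule continuous_on_tendsto_compose[OF lipschitz_on_continuous_on[OF nbhd(3)] lim_z zs_in_N])
    (simp add: z_in_N)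

text \<open>By the Newton equation \<open>H (z (Suc i)) *v p i\<close> is \<open>- g (z i)\<close>
  up to \<open>(H (z (Suc i)) - H (z i)) *v p i\<close>, which vanishes in the limit because the
  Hessians converge and the directions stay bounded. No lower bound on \<open>\<alpha> i\<close>
  enters.\<close>

lemma stationary: "g zs = 0"
proof (rule ccontr)
  assume ne: "g zs \<noteq> 0"
  have K: "norm (p i) \<le> K * norm (g (z 0))" for i
    by (rule order_trans[OF norm_dir]) (intro mult_left_mono residual_le_initial K_nonneg)
  have HS: "(\<lambda>i. H (z (Suc i)) - H (z i)) \<longlonglongrightarrow> 0"
    using tendsto_diff[OF LIMSEQ_Suc[OF lim_H] lim_H] by simp
  have "(\<lambda>i. norm (H (z (Suc i)) - H (z i)) * (K * norm (g (z 0)))) \<longlonglongrightarrow> 0"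
    using tendsto_mult[OF tendsto_norm[OF HS] tendsto_const[of "K * norm (g (z 0))"]] by simp
  then have "(\<lambda>i. (H (z (Suc i)) - H (z i)) *v p i) \<longlonglongrightarrow> 0"
  proof (rule Lim_null_comparison[rotated])
    have "norm ((H (z (Suc i)) - H (z i)) *v p i) \<le> norm (H (z (Suc i)) - H (z i)) * (K * norm (g (z 0)))" for i
      by (rule order_trans[OF norm_matrix_vector_mult_le]) (intro mult_left_mono K norm_ge_zero)
    then show "\<forall>\<^sub>F i in sequentially. norm ((H (z (Suc i)) - H (z i)) *v p i)
        \<le> norm (H (z (Suc i)) - H (z i)) * (K * norm (g (z 0)))"
      by simp
  qed
  then have "(\<lambda>i. (H (z (Suc i)) - H (z i)) *v p i + - g (z i)) \<longlonglongrightarrow> 0 + - g zs"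
    by (intro tendsto_add tendsto_minus lim_g)
  then have "(\<lambda>i. H (z (Suc i)) *v p i) \<longlonglongrightarrow> - g zs"
    using newton by (simp add: matrix_vector_mult_diff_rdistrib)
  then have "(\<lambda>i. g (z (Suc i)) \<bullet> (H (z (Suc i)) *v p i)) \<longlonglongrightarrow> g zs \<bullet> (- g zs)"
    by (intro tendsto_inner LIMSEQ_Suc[OF lim_g])
  moreover have "(\<lambda>i. - c2 * (norm (g (z i)))\<^sup>2) \<longlonglongrightarrow> - c2 * (norm (g zs))\<^sup>2"
    by (intro tendsto_intros lim_g)
  ultimately have "- c2 * (norm (g zs))\<^sup>2 \<le> g zs \<bullet> (- g zs)"
    using curvature by (intro LIMSEQ_le) auto
  then have "(norm (g zs))\<^sup>2 \<le> c2 * (norm (g zs))\<^sup>2"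
    by (simp add: power2_norm_eq_inner)
  moreover have "0 < (norm (g zs))\<^sup>2" using ne by simp
  ultimately show False using params by simp
qed

section \<open>Rate of convergence\<close>

lemma quadratic_unit_steps:
  "\<exists>C. \<exists>\<epsilon>>0. \<forall>i. norm (z i - zs) < \<epsilon> \<and> \<alpha> i = 1 \<longrightarrow> norm (z (Suc i) - zs) \<le> C * (norm (z i - zs))\<^sup>2"
proof -
  \<comment> \<open>\<open>N\<close> need not be convex, whereas the remainder estimate needs a
    segment: hence a ball around the limit.\<close>
  obtain r where r: "0 < r" "ball zs r \<subseteq> N"
    using nbhd(1) zs_in_N openE by blast
  have lip: "L-lipschitz_on (ball zs r) H"
    using nbhd(3) r(2) lipschitz_on_subset by blast
  have "norm (z (Suc i) - zs) \<le> (K * L) * (norm (z i - zs))\<^sup>2"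
    if "norm (z i - zs) < r" "\<alpha> i = 1" for i
  proof -
    have "norm (g zs - g (z i) - H (z i) *v (zs - z i)) \<le> L * (norm (zs - z i))\<^sup>2"
      using remainder_bound[OF lip convex_ball, of "z i" zs] that r
      by (simp add: dist_norm norm_minus_commute)
    \<comment> \<open>Since \<open>g zs = 0\<close> and \<open>- g (z i) = H (z i) *v p i\<close>,
      the Taylor remainder at \<open>z i\<close> is the Hessian applied to the new error.\<close>
    moreover have "g zs - g (z i) - H (z i) *v (zs - z i) = H (z i) *v (z (Suc i) - zs)"
      using newton[of i] that(2) stationary
      by (simp add: step matrix_vector_mult_add_rdistrib matrix_vector_mult_diff_distrib algebra_simps
          matrix_vector_right_distrib)
    ultimately have "norm (H (z i) *v (z (Suc i) - zs)) \<le> L * (norm (zs - z i))\<^sup>2" by simp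
    then have "K * norm (H (z i) *v (z (Suc i) - zs)) \<le> K * (L * (norm (zs - z i))\<^sup>2)"
      using K_nonneg mult_left_mono by blast
    then show ?thesis
      using norm_le_image[of "z (Suc i) - zs" "z i"] by (simp add: norm_minus_commute)
  qed
  then show ?thesis using r(1) by blast
qed

text \<open>Compare orders in the old residual \<open>n\<close>: a full step leaves a residual of
  order \<open>n^2\<close>, so its square is of order \<open>n^4\<close> against the allowed
  \<open>(1 - 2 * c1) * n^2\<close>, which is positive as \<open>c1 < 1/2\<close>; the new slope is
  of order \<open>n^3\<close> against \<open>c2 * n^2\<close>.\<close>

lemma unit_step_accepted:
  assumes "c1 < 1/2"
  shows "\<forall>\<^sub>F i in sequentially.
     (norm (g (z i + p i)))\<^sup>2 \<le> (norm (g (z i)))\<^sup>2 - 2 * c1 * (norm (g (z i)))\<^sup>2 \<and>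
     g (z i + p i) \<bullet> (H (z i + p i) *v p i) \<ge> - c2 * (norm (g (z i)))\<^sup>2"
proof -
  obtain r where r: "0 < r" "ball zs r \<subseteq> N"
    using nbhd(1) zs_in_N openE by blast
  have lip: "L-lipschitz_on (ball zs r) H"
    using nbhd(3) r(2) lipschitz_on_subset by blast
  have L: "0 \<le> L" using lipschitz_on_nonneg[OF lip] .
  have g0: "(\<lambda>i. norm (g (z i))) \<longlonglongrightarrow> 0"
    using tendsto_norm[OF lim_g] stationary by simp
  have "(\<lambda>i. K * norm (g (z i))) \<longlonglongrightarrow> 0"
    using tendsto_mult[OF tendsto_const[of K] g0] by simp
  then have p0: "p \<longlonglongrightarrow> 0"
    by (rule Lim_null_comparison[rotated]) (simp add: norm_dir)
  \<comment> \<open>The trial points \<open>z i + p i\<close> need not be iterates, so their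
    convergence is derived from that of \<open>p\<close>.\<close>
  have zp: "(\<lambda>i. z i + p i) \<longlonglongrightarrow> zs" using tendsto_add[OF lim_z p0] by simp
  have ev1: "\<forall>\<^sub>F i in sequentially. z i \<in> ball zs r" "\<forall>\<^sub>F i in sequentially. z i + p i \<in> ball zs r"
    using topological_tendstoD[OF lim_z open_ball] topological_tendstoD[OF zp open_ball] r(1) by auto
  \<comment> \<open>\<open>A\<close> comes from the remainder bound with
    \<open>norm (p i) \<le> K * norm (g (z i))\<close>; \<open>M\<close> bounds \<open>H\<close> on
    the ball.\<close>
  define A where "A = L * K\<^sup>2"
  define M where "M = norm (H zs) + L * r"
  have A: "0 \<le> A" and M: "0 \<le> M" using L r by (simp_all add: A_def M_def)
  have "(\<lambda>i. (A * norm (g (z i)))\<^sup>2) \<longlonglongrightarrow> (A * 0)\<^sup>2" by (intro tendsto_intros g0)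
  then have ev2: "\<forall>\<^sub>F i in sequentially. (A * norm (g (z i)))\<^sup>2 < 1 - 2 * c1"
    using assms by (intro order_tendstoD(2)[where y = "(A * 0)\<^sup>2"]) auto
  have "(\<lambda>i. A * M * K * norm (g (z i))) \<longlonglongrightarrow> A * M * K * 0" by (intro tendsto_intros g0)
  then have ev3: "\<forall>\<^sub>F i in sequentially. A * M * K * norm (g (z i)) < c2"
    using params by (intro order_tendstoD(2)[where y = "A * M * K * 0"]) auto
  show ?thesis
    using ev1 ev2 ev3
  proof eventually_elim
    case (elim i)
    let ?n = "norm (g (z i))"
    have "norm (g (z i + p i)) \<le> L * (norm (p i))\<^sup>2"
      using remainder_bound[OF lip convex_ball elim(1,2)] newton[of i] by simp
    also have "\<dots> \<le> L * (K * ?n)\<^sup>2"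
      using norm_dir L by (intro mult_left_mono power_mono) auto
    finally have gp: "norm (g (z i + p i)) \<le> A * ?n\<^sup>2" by (simp add: A_def power_mult_distrib)
    have "(norm (g (z i + p i)))\<^sup>2 \<le> (A * ?n\<^sup>2)\<^sup>2" using gp by (intro power_mono) auto
    also have "\<dots> = (A * ?n)\<^sup>2 * ?n\<^sup>2" by (simp add: power2_eq_square)
    also have "\<dots> \<le> (1 - 2 * c1) * ?n\<^sup>2" using elim(3) by (intro mult_right_mono) auto
    finally have 1: "(norm (g (z i + p i)))\<^sup>2 \<le> ?n\<^sup>2 - 2 * c1 * ?n\<^sup>2" by (simp add: algebra_simps)
    have "norm (H (z i + p i) - H zs) \<le> L * r"
    proof -
      have "norm (H (z i + p i) - H zs) \<le> L * norm (z i + p i - zs)"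
        using lipschitz_onD[OF lip elim(2), of zs] r by (simp add: dist_norm)
      also have "\<dots> \<le> L * r" using elim(2) L
        by (intro mult_left_mono) (auto simp: dist_norm norm_minus_commute)
      finally show ?thesis .
    qed
    then have HM: "norm (H (z i + p i)) \<le> M"
      using norm_triangle_sub[of "H (z i + p i)" "H zs"] by (simp add: M_def)
    have "\<bar>g (z i + p i) \<bullet> (H (z i + p i) *v p i)\<bar> \<le> norm (g (z i + p i)) * norm (H (z i + p i) *v p i)"
      by (rule Cauchy_Schwarz_ineq2)
    also have "\<dots> \<le> (A * ?n\<^sup>2) * (M * (K * ?n))"
    proof (intro mult_mono gp)
      have "norm (H (z i + p i) *v p i) \<le> norm (H (z i + p i)) * norm (p i)"
        by (rule norm_matrix_vector_mult_le)
      also have "\<dots> \<le> M * (K * ?n)" using HM norm_dir M by (intro mult_mono) auto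
      finally show "norm (H (z i + p i) *v p i) \<le> M * (K * ?n)" .
    qed (use A in auto)
    also have "\<dots> = (A * M * K * ?n) * ?n\<^sup>2" by (simp add: power2_eq_square)
    also have "\<dots> \<le> c2 * ?n\<^sup>2" using elim(4) by (intro mult_right_mono) auto
    finally have "- c2 * ?n\<^sup>2 \<le> g (z i + p i) \<bullet> (H (z i + p i) *v p i)" by simp
    with 1 show ?case by blast
  qed
qed

lemma fixed_at_limit: "z (Suc i) = zs" if "z i = zs"
proof -
  have "p i = 0" using norm_dir[of i] that stationary by simp
  then show ?thesis using that by (simp add: step)
qed

text \<open>Only finitely many steps precede the unit steps. Their error ratios are absorbed into
  the constant, so the radius \<epsilon> is kept.\<close>

lemma quadratic_eventually_unit:
  assumes "\<forall>\<^sub>F i in sequentially. \<alpha> i = 1"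
  shows "\<exists>C. \<exists>\<epsilon>>0. \<forall>i. norm (z i - zs) < \<epsilon> \<longrightarrow> norm (z (Suc i) - zs) \<le> C * (norm (z i - zs))\<^sup>2"
proof -
  obtain C \<epsilon> where \<epsilon>: "0 < \<epsilon>" and C: "\<And>i. norm (z i - zs) < \<epsilon> \<Longrightarrow> \<alpha> i = 1 \<Longrightarrow>
      norm (z (Suc i) - zs) \<le> C * (norm (z i - zs))\<^sup>2"
    using quadratic_unit_steps by blast
  obtain i0 where i0: "\<And>i. i \<ge> i0 \<Longrightarrow> \<alpha> i = 1"
    using assms by (auto simp: eventually_sequentially)
  \<comment> \<open>At the limit the quotient is 0 by division by zero; this is consistent, since by
    \<open>fixed_at_limit\<close> the next error is then 0 too. As all \<open>B i\<close> are
    nonnegative, their sum dominates each of them.\<close>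
  define B where "B i = norm (z (Suc i) - zs) / (norm (z i - zs))\<^sup>2" for i
  define D where "D = max C (\<Sum>i<i0. B i)"
  have B0: "0 \<le> B i" for i by (simp add: B_def)
  have "norm (z (Suc i) - zs) \<le> D * (norm (z i - zs))\<^sup>2" if "norm (z i - zs) < \<epsilon>" for i
  proof (cases "i < i0")
    case True
    have "norm (z (Suc i) - zs) \<le> B i * (norm (z i - zs))\<^sup>2"
      using fixed_at_limit[of i] by (cases "z i = zs") (auto simp: B_def)
    also have "B i \<le> D"
      using member_le_sum[of i "{..<i0}" B] True B0 by (auto simp: D_def)
    finally show ?thesis by (simp add: mult_right_mono)
  next
    case False
    then have "norm (z (Suc i) - zs) \<le> C * (norm (z i - zs))\<^sup>2" using C that i0 by simp
    also have "\<dots> \<le> D * (norm (z i - zs))\<^sup>2" by (intro mult_right_mono) (auto simp: D_def)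
    finally show ?thesis .
  qed
  then show ?thesis using \<epsilon> by blast
qed

end

section \<open>Twice differentiable functions\<close>

text \<open>In \<open>f2 x u v\<close> the derivative along \<open>v\<close> is differentiated along \<open>u\<close>.\<close>

definition twice_deriv :: "('a::real_normed_vector \<Rightarrow> 'b::real_normed_vector) \<Rightarrow> ('a \<Rightarrow> 'a \<Rightarrow> 'b) \<Rightarrow>
    ('a \<Rightarrow> 'a \<Rightarrow> 'a \<Rightarrow> 'b) \<Rightarrow> bool"
  where "twice_deriv f f1 f2 \<longleftrightarrow> (\<forall>x. (f has_derivative f1 x) (at x)) \<and>
      (\<forall>x v. ((\<lambda>x. f1 x v) has_derivative (\<lambda>u. f2 x u v)) (at x))"

lemma twice_derivI:
  assumes "\<And>x. (f has_derivative f1 x) (at x)"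
    and "\<And>x v. ((\<lambda>x. f1 x v) has_derivative (\<lambda>u. f2 x u v)) (at x)"
  shows "twice_deriv f f1 f2"
  using assms unfolding twice_deriv_def by blast

lemma twice_derivD:
  assumes "twice_deriv f f1 f2"
  shows "(f has_derivative f1 x) (at x)"
    and "((\<lambda>x. f1 x v) has_derivative (\<lambda>u. f2 x u v)) (at x)"
  using assms unfolding twice_deriv_def by blast+

lemma C2_imp_twice_deriv:
  assumes "C2 f"
  obtains f1 f2 where "twice_deriv f f1 f2"
proof -
  obtain f' f'' where f': "\<And>x. (f has_derivative blinfun_apply (f' x)) (at x)"
    and f'': "\<And>x. (f' has_derivative blinfun_apply (f'' x)) (at x)"
    using assms unfolding C2_def by blast
  have "((\<lambda>x. blinfun_apply (f' x) v) has_derivative (\<lambda>u. blinfun_apply (blinfun_apply (f'' x) u) v)) (at x)"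
    for x v
    by (rule bounded_linear.has_derivative[OF bounded_bilinear.bounded_linear_left[OF bounded_bilinear_blinfun_apply] f''])
  then have "twice_deriv f (\<lambda>x. blinfun_apply (f' x)) (\<lambda>x u. blinfun_apply (blinfun_apply (f'' x) u))"
    using f' by (intro twice_derivI) auto
  then show ?thesis by (rule that)
qed

lemma twice_deriv_cong:
  assumes "twice_deriv f f1 f2" and "\<And>x. f x = g x" and "\<And>x v. f1 x v = g1 x v" and "\<And>x u v. f2 x u v = g2 x u v"
  shows "twice_deriv g g1 g2"
proof -
  have "f = g" "f1 = g1" "f2 = g2" using assms(2-) by (intro ext; simp)+
  then show ?thesis using assms(1) by simp
qed

lemma twice_deriv_const: "twice_deriv (\<lambda>_. c) (\<lambda>_ _. 0) (\<lambda>_ _ _. 0)"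
  by (intro twice_derivI has_derivative_const)

lemma twice_deriv_bounded_linear:
  assumes "bounded_linear f"
  shows "twice_deriv f (\<lambda>_. f) (\<lambda>_ _ _. 0)"
  by (intro twice_derivI has_derivative_const bounded_linear_imp_has_derivative assms)

lemma twice_deriv_compose_linear:
  assumes "bounded_linear A" and "twice_deriv f f1 f2"
  shows "twice_deriv (\<lambda>x. A (f x)) (\<lambda>x v. A (f1 x v)) (\<lambda>x u v. A (f2 x u v))"
  by (intro twice_derivI bounded_linear.has_derivative[OF assms(1)] twice_derivD[OF assms(2)])

lemma twice_deriv_add:
  assumes "twice_deriv f f1 f2" and "twice_deriv g g1 g2"
  shows "twice_deriv (\<lambda>x. f x + g x) (\<lambda>x v. f1 x v + g1 x v) (\<lambda>x u v. f2 x u v + g2 x u v)"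
  by (intro twice_derivI has_derivative_add twice_derivD[OF assms(1)] twice_derivD[OF assms(2)])

lemma twice_deriv_diff:
  assumes "twice_deriv f f1 f2" and "twice_deriv g g1 g2"
  shows "twice_deriv (\<lambda>x. f x - g x) (\<lambda>x v. f1 x v - g1 x v) (\<lambda>x u v. f2 x u v - g2 x u v)"
  by (intro twice_derivI has_derivative_diff twice_derivD[OF assms(1)] twice_derivD[OF assms(2)])

lemma twice_deriv_sum:
  assumes "\<And>i. i \<in> I \<Longrightarrow> twice_deriv (f i) (f1 i) (f2 i)"
  shows "twice_deriv (\<lambda>x. \<Sum>i\<in>I. f i x) (\<lambda>x v. \<Sum>i\<in>I. f1 i x v) (\<lambda>x u v. \<Sum>i\<in>I. f2 i x u v)"
  by (intro twice_derivI has_derivative_sum) (erule twice_derivD[OF assms])+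

lemma twice_deriv_cmult:
  fixes f :: "'a::real_normed_vector \<Rightarrow> real"
  assumes "twice_deriv f f1 f2"
  shows "twice_deriv (\<lambda>x. c * f x) (\<lambda>x v. c * f1 x v) (\<lambda>x u v. c * f2 x u v)"
  by (rule twice_deriv_compose_linear[OF bounded_linear_mult_right assms])

text \<open>The derivative \<open>A\<close> is the same at every point, so \<open>g\<close> is
  affine and the chain rule produces no second derivative of \<open>g\<close>. Selecting a stage
  from the stacked vector and fixing one argument of a pair are of this kind.\<close>

lemma twice_deriv_affine:
  assumes f: "twice_deriv f f1 f2" and g: "\<And>y. (g has_derivative A) (at y)"
  shows "twice_deriv (\<lambda>y. f (g y)) (\<lambda>y v. f1 (g y) (A v)) (\<lambda>y u v. f2 (g y) (A u) (A v))"
proof (rule twice_derivI)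
  show "((\<lambda>y. f (g y)) has_derivative (\<lambda>v. f1 (g y) (A v))) (at y)" for y
    by (rule has_derivative_compose[OF g twice_derivD(1)[OF f]])
  show "((\<lambda>y. f1 (g y) (A v)) has_derivative (\<lambda>u. f2 (g y) (A u) (A v))) (at y)" for y v
    by (rule has_derivative_compose[OF g twice_derivD(2)[OF f]])
qed

text \<open>The first summand of the second derivative is the Gauss-Newton part. The second,
  weighted by the residual, is the origin of the curvature corrections in \<open>lbar_xx\<close>,
  \<open>lbar_xu\<close>, \<open>lbar_uu\<close> and \<open>meas_curv\<close>.\<close>

lemma twice_deriv_quadratic_form:
  fixes M :: "real^'n^'n"
  assumes a: "twice_deriv a a1 a2" and M: "transpose M = M"
  shows "twice_deriv (\<lambda>x. a x \<bullet> (M *v a x)) (\<lambda>x v. 2 * (a1 x v \<bullet> (M *v a x)))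
    (\<lambda>x u v. 2 * (a1 x v \<bullet> (M *v a1 x u)) + 2 * (a2 x u v \<bullet> (M *v a x)))"
proof (rule twice_derivI)
  have lin: "bounded_linear ((*v) M)" by (rule matrix_vector_mul_bounded_linear)
  have sym: "y \<bullet> (M *v w) = w \<bullet> (M *v y)" for y w
    using dot_lmul_matrix[of y M w] M by (metis inner_commute vector_transpose_matrix)
  note Ma = bounded_linear.has_derivative[OF lin twice_derivD(1)[OF a]]
  show "((\<lambda>x. a x \<bullet> (M *v a x)) has_derivative (\<lambda>v. 2 * (a1 x v \<bullet> (M *v a x)))) (at x)" for x
    by (rule has_derivative_eq_rhs[OF has_derivative_inner[OF twice_derivD(1)[OF a] Ma]])
      (simp add: fun_eq_iff sym[of "a x"])
  show "((\<lambda>x. 2 * (a1 x v \<bullet> (M *v a x))) has_derivative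
      (\<lambda>u. 2 * (a1 x v \<bullet> (M *v a1 x u)) + 2 * (a2 x u v \<bullet> (M *v a x)))) (at x)" for x v
    by (rule has_derivative_eq_rhs[OF has_derivative_mult_right[OF has_derivative_inner[OF twice_derivD(2)[OF a] Ma]]])
      (simp add: fun_eq_iff)
qed

section \<open>Linearity and symmetry of second derivatives\<close>

text \<open>Linearity in \<open>u\<close> is part of being a derivative. Linearity in
  \<open>v\<close> is inherited from \<open>f1 x\<close> by uniqueness of derivatives.\<close>

lemma twice_deriv_linear:
  assumes "twice_deriv f f1 f2"
  shows "linear (f1 x)" and "linear (\<lambda>u. f2 x u v)" and "linear (f2 x u)"
proof -
  note D = twice_derivD[OF assms]
  show l1: "linear (f1 y)" for y using D(1) has_derivative_linear by blast
  show "linear (\<lambda>u. f2 x u v)" using D(2) has_derivative_linear by blast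
  show "linear (f2 x u)"
  proof (rule linearI)
    fix v w c
    have "((\<lambda>x. f1 x (v + w)) has_derivative (\<lambda>u. f2 x u v + f2 x u w)) (at x)"
      using has_derivative_add[OF D(2) D(2)] by (simp add: linear_add[OF l1])
    then show "f2 x u (v + w) = f2 x u v + f2 x u w"
      using has_derivative_unique[OF D(2)] by metis
    have "((\<lambda>x. f1 x (c *\<^sub>R v)) has_derivative (\<lambda>u. c *\<^sub>R f2 x u v)) (at x)"
      using has_derivative_scaleR_right[OF D(2)] by (simp add: linear_scale[OF l1])
    then show "f2 x u (c *\<^sub>R v) = c *\<^sub>R f2 x u v"
      using has_derivative_unique[OF D(2)] by metis
  qed
qed

text \<open>The second difference of \<open>f\<close> along \<open>h u\<close>, \<open>h v\<close> is symmetric in \<open>u\<close> and \<open>v\<close> and, by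
  the mean value theorem in the direction \<open>u\<close>, close to \<open>h\<^sup>2\<close> times the second derivative.\<close>

lemma second_difference_estimate:
  fixes f :: "'a::real_normed_vector \<Rightarrow> real"
  assumes f: "twice_deriv f f1 f2" and e: "0 < e"
  shows "\<forall>\<^sub>F h in at_right 0. \<bar>f (x + h *\<^sub>R u + h *\<^sub>R v) - f (x + h *\<^sub>R u) - f (x + h *\<^sub>R v) + f x
      - h\<^sup>2 * f2 x v u\<bar> \<le> e * h\<^sup>2 * (2 * norm u + norm v)"
proof -
  note D = twice_derivD[OF f]
  have l: "linear (\<lambda>w. f2 x w u)" by (rule twice_deriv_linear(2)[OF f])
  obtain d where d: "0 < d" and near: "\<And>y. norm (y - x) < d \<Longrightarrow>
      norm (f1 y u - f1 x u - f2 x (y - x) u) \<le> e * norm (y - x)"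
    using D(2)[of u x] e unfolding has_derivative_at_alt by blast
  \<comment> \<open>For \<open>h * n < d\<close> both points at which the derivative is compared
    with its linearisation lie within \<open>d\<close> of \<open>x\<close>; the summand 1 keeps
    \<open>n\<close> positive when \<open>u\<close> and \<open>v\<close> vanish.\<close>
  define n where "n = norm u + norm v + 1"
  have n: "0 < n" by (simp add: n_def add_nonneg_pos)
  have est: "\<bar>f (x + h *\<^sub>R u + h *\<^sub>R v) - f (x + h *\<^sub>R u) - f (x + h *\<^sub>R v) + f x
      - h\<^sup>2 * f2 x v u\<bar> \<le> e * h\<^sup>2 * (2 * norm u + norm v)" if h: "0 < h" "h < d / n" for h
  proof -
    define \<psi> where "\<psi> s = f (x + h *\<^sub>R v + s *\<^sub>R u) - f (x + s *\<^sub>R u)" for s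
    have line: "((\<lambda>s. f (y + s *\<^sub>R u)) has_real_derivative f1 (y + s *\<^sub>R u) u) (at s)" for y s
    proof -
      have "((\<lambda>s. f (y + s *\<^sub>R u)) has_derivative (\<lambda>r. f1 (y + s *\<^sub>R u) (r *\<^sub>R u))) (at s)"
        by (rule has_derivative_compose[OF _ D(1)]) (auto intro!: derivative_eq_intros)
      then show ?thesis
        by (simp add: has_field_derivative_def linear_scale[OF twice_deriv_linear(1)[OF f]] mult_commute_abs)
    qed
    have "(\<psi> has_real_derivative f1 (x + h *\<^sub>R v + s *\<^sub>R u) u - f1 (x + s *\<^sub>R u) u) (at s)" for s
      unfolding \<psi>_def by (intro DERIV_diff line)
    then obtain s where s: "0 < s" "s < h" and
        eq: "\<psi> h - \<psi> 0 = (h - 0) * (f1 (x + h *\<^sub>R v + s *\<^sub>R u) u - f1 (x + s *\<^sub>R u) u)"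
      using MVT2[OF h(1), of \<psi> "\<lambda>s. f1 (x + h *\<^sub>R v + s *\<^sub>R u) u - f1 (x + s *\<^sub>R u) u"] by blast
    have hn: "h * n < d" using h(2) n by (simp add: pos_less_divide_eq)
    have su: "norm (s *\<^sub>R u) \<le> h * norm u" using s by (simp add: mult_right_mono)
    have shu: "norm (h *\<^sub>R v + s *\<^sub>R u) \<le> h * norm v + h * norm u"
      using norm_triangle_ineq[of "h *\<^sub>R v" "s *\<^sub>R u"] su h by simp
    have "h * norm v + h * norm u < h * n" "h * norm u < h * n"
      using h(1) by (simp_all add: n_def distrib_left add_nonneg_pos)
    then have lt: "norm (h *\<^sub>R v + s *\<^sub>R u) < d" "norm (s *\<^sub>R u) < d"
      using su shu hn by linarith+
    have 1: "\<bar>f1 (x + h *\<^sub>R v + s *\<^sub>R u) u - f1 x u - f2 x (h *\<^sub>R v + s *\<^sub>R u) u\<bar> \<le> e * (h * norm v + h * norm u)"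
      by (rule order_trans[OF _ mult_left_mono[OF shu]])
        (use near[of "x + h *\<^sub>R v + s *\<^sub>R u"] lt(1) e in \<open>simp_all add: add.assoc\<close>)
    have 2: "\<bar>f1 (x + s *\<^sub>R u) u - f1 x u - f2 x (s *\<^sub>R u) u\<bar> \<le> e * (h * norm u)"
      by (rule order_trans[OF _ mult_left_mono[OF su]])
        (use near[of "x + s *\<^sub>R u"] lt(2) e in simp_all)
    have "f2 x (h *\<^sub>R v + s *\<^sub>R u) u = h * f2 x v u + f2 x (s *\<^sub>R u) u"
      using linear_add[OF l] linear_scale[OF l] by simp
    then have "\<bar>f1 (x + h *\<^sub>R v + s *\<^sub>R u) u - f1 (x + s *\<^sub>R u) u - h * f2 x v u\<bar>
        \<le> e * (h * norm v + h * norm u) + e * (h * norm u)"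
      using 1 2 by linarith
    then have "h * \<bar>f1 (x + h *\<^sub>R v + s *\<^sub>R u) u - f1 (x + s *\<^sub>R u) u - h * f2 x v u\<bar>
        \<le> h * (e * (h * norm v + h * norm u) + e * (h * norm u))"
      using h by (intro mult_left_mono) auto
    moreover have "h * \<bar>f1 (x + h *\<^sub>R v + s *\<^sub>R u) u - f1 (x + s *\<^sub>R u) u - h * f2 x v u\<bar>
        = \<bar>(\<psi> h - \<psi> 0) - h\<^sup>2 * f2 x v u\<bar>"
      unfolding eq using h by (simp add: abs_mult_pos' right_diff_distrib power2_eq_square mult.assoc)
    ultimately show ?thesis
      by (simp add: \<psi>_def algebra_simps power2_eq_square)
  qed
  show ?thesis
    unfolding eventually_at_right_field
    using est d n by (intro exI[of _ "d / n"]) auto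
qed

lemma twice_deriv_symmetric_real:
  fixes f :: "'a::real_normed_vector \<Rightarrow> real"
  assumes f: "twice_deriv f f1 f2"
  shows "f2 x u v = f2 x v u"
proof -
  \<comment> \<open>The error factors \<open>2 * norm u + norm v\<close> and
    \<open>2 * norm v + norm u\<close> of the two estimates add up to \<open>n\<close>.\<close>
  define n where "n = 3 * norm u + 3 * norm v"
  have bound: "\<bar>f2 x u v - f2 x v u\<bar> \<le> e * n" if e: "0 < e" for e
  proof -
    have "\<forall>\<^sub>F h in at_right (0::real). h > 0" by (simp add: eventually_at_right_less)
    with second_difference_estimate[OF f e, of x u v] second_difference_estimate[OF f e, of x v u]
    have "\<forall>\<^sub>F h in at_right (0::real). \<bar>f2 x u v - f2 x v u\<bar> \<le> e * n"
    proof eventually_elim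
      case (elim h)
      let ?\<Delta> = "f (x + h *\<^sub>R u + h *\<^sub>R v) - f (x + h *\<^sub>R u) - f (x + h *\<^sub>R v) + f x"
      have eq: "f (x + h *\<^sub>R v + h *\<^sub>R u) - f (x + h *\<^sub>R v) - f (x + h *\<^sub>R u) + f x = ?\<Delta>"
        by (simp add: add.assoc add.commute[of "h *\<^sub>R v"])
      have "\<bar>h\<^sup>2 * f2 x u v - h\<^sup>2 * f2 x v u\<bar> \<le> e * h\<^sup>2 * (2 * norm u + norm v) + e * h\<^sup>2 * (2 * norm v + norm u)"
        using elim(1,2) unfolding eq by linarith
      also have "\<dots> = h\<^sup>2 * (e * n)" by (simp add: n_def algebra_simps)
      finally have "h\<^sup>2 * \<bar>f2 x u v - f2 x v u\<bar> \<le> h\<^sup>2 * (e * n)"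
        by (simp add: right_diff_distrib[symmetric] abs_mult)
      then show ?case using elim(3) by simp
    qed
    then show ?thesis by simp
  qed
  have n: "0 \<le> n" by (simp add: n_def)
  have "\<bar>f2 x u v - f2 x v u\<bar> \<le> 0"
  proof (rule field_le_epsilon)
    fix e :: real assume e: "0 < e"
    \<comment> \<open>\<open>n\<close> may be 0, hence the division by \<open>n + 1\<close>.\<close>
    have "\<bar>f2 x u v - f2 x v u\<bar> \<le> e / (n + 1) * n" using e n by (intro bound) auto
    also have "\<dots> \<le> e" using e n by (simp add: field_simps)
    finally show "\<bar>f2 x u v - f2 x v u\<bar> \<le> 0 + e" by simp
  qed
  then show ?thesis by simp
qed

lemma twice_deriv_symmetric:
  fixes f :: "'a::real_normed_vector \<Rightarrow> 'b::real_inner"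
  assumes f: "twice_deriv f f1 f2"
  shows "f2 x u v = f2 x v u"
proof -
  have "f2 x u v \<bullet> b = f2 x v u \<bullet> b" for b
    by (rule twice_deriv_symmetric_real[OF twice_deriv_compose_linear[OF bounded_linear_inner_left f]])
  then show ?thesis using vector_eq_rdot by blast
qed

section \<open>Gradients and Hessians as linear and bilinear forms\<close>

text \<open>\<open>grad\<close> is a definite description, so the representing vector must be
  exhibited, by its coordinates in the basis, and shown to be unique.\<close>

lemma inner_grad:
  fixes f :: "'a::euclidean_space \<Rightarrow> real"
  assumes "(f has_derivative f') (at x)"
  shows "grad f x \<bullet> v = f' v"
proof -
  have rep: "h \<bullet> (\<Sum>b\<in>Basis. f' b *\<^sub>R b) = f' h" for h
  proof -
    have "f' h = f' (\<Sum>b\<in>Basis. (h \<bullet> b) *\<^sub>R b)" by (simp add: euclidean_representation)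
    also have "\<dots> = (\<Sum>b\<in>Basis. (h \<bullet> b) * f' b)"
      using has_derivative_linear[OF assms] by (simp add: linear_sum linear_scale)
    finally show ?thesis by (simp add: inner_sum_right mult.commute)
  qed
  then have 1: "GDERIV f x :> (\<Sum>b\<in>Basis. f' b *\<^sub>R b)"
    using assms by (simp add: gderiv_def rep)
  have 2: "D = (\<Sum>b\<in>Basis. f' b *\<^sub>R b)" if "GDERIV f x :> D" for D
  proof -
    have "(\<lambda>h. h \<bullet> D) = f'"
      using has_derivative_unique[OF _ assms] that unfolding gderiv_def by blast
    then have "h \<bullet> D = h \<bullet> (\<Sum>b\<in>Basis. f' b *\<^sub>R b)" for h by (simp add: rep fun_eq_iff)
    then show ?thesis using vector_eq_ldot by blast
  qed
  have "grad f x = (\<Sum>b\<in>Basis. f' b *\<^sub>R b)"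
    unfolding grad_def using 1 2 by (rule the_equality)
  then show ?thesis using rep[of v] by (simp add: inner_commute)
qed

lemma jacobian_mult:
  fixes f :: "real^'n \<Rightarrow> real^'m"
  assumes "(f has_derivative f') (at x)"
  shows "jacobian f (at x) *v h = f' h"
  using frechet_derivative_at[OF assms] has_derivative_linear[OF assms]
  by (simp add: jacobian_def matrix_works)

lemma grad_has_derivative:
  fixes f :: "'a::euclidean_space \<Rightarrow> real"
  assumes f: "twice_deriv f f1 f2"
  shows "(grad f has_derivative (\<lambda>u. \<Sum>b\<in>Basis. f2 x u b *\<^sub>R b)) (at x)"
proof -
  have "grad f = (\<lambda>y. \<Sum>b\<in>Basis. f1 y b *\<^sub>R b)"
    by (intro ext) (subst euclidean_representation[symmetric], simp add: inner_grad[OF twice_derivD(1)[OF f]])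
  then show ?thesis
    by (auto intro!: has_derivative_sum has_derivative_scaleR_left twice_derivD(2)[OF f])
qed

lemma hess_mult:
  fixes f :: "real^'n \<Rightarrow> real"
  assumes f: "twice_deriv f f1 f2"
  shows "hess f x *v u = (\<Sum>b\<in>Basis. f2 x u b *\<^sub>R b)"
  unfolding hess_def by (rule jacobian_mult[OF grad_has_derivative[OF f]])

lemma grad_has_derivative_hess:
  fixes f :: "real^'n \<Rightarrow> real"
  assumes f: "twice_deriv f f1 f2"
  shows "(grad f has_derivative (\<lambda>h. hess f x *v h)) (at x)"
  unfolding hess_mult[OF f] by (rule grad_has_derivative[OF f])

lemma inner_hess:
  fixes f :: "real^'n \<Rightarrow> real"
  assumes f: "twice_deriv f f1 f2"
  shows "(hess f x *v u) \<bullet> v = f2 x u v"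
proof -
  have "(hess f x *v u) \<bullet> v = (\<Sum>b\<in>Basis. (v \<bullet> b) * f2 x u b)"
    by (simp add: hess_mult[OF f] inner_sum_left inner_commute[of v] mult.commute)
  also have "\<dots> = f2 x u (\<Sum>b\<in>Basis. (v \<bullet> b) *\<^sub>R b)"
    using twice_deriv_linear(3)[OF f] by (simp add: linear_sum linear_scale)
  finally show ?thesis by (simp add: euclidean_representation)
qed

lemma has_derivative_Pair_left: "((\<lambda>\<xi>. (\<xi>, c)) has_derivative (\<lambda>a. (a, 0))) (at x)"
  by (auto intro!: derivative_eq_intros)

lemma has_derivative_Pair_right: "((\<lambda>\<nu>. (c, \<nu>)) has_derivative (\<lambda>a. (0, a))) (at x)"
  by (auto intro!: derivative_eq_intros)

text \<open>\<open>hess_xu\<close> takes the gradient in \<open>x\<close> first and differentiates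
  it in \<open>u\<close>, so \<open>b\<close> belongs in the first slot of
  \<open>f2\<close>.\<close>

lemma inner_hess_xu:
  fixes f :: "(real^'n) \<times> (real^'m) \<Rightarrow> real"
  assumes f: "twice_deriv f f1 f2"
  shows "(hess_xu f x u *v b) \<bullet> a = f2 (x, u) (0, b) (a, 0)"
proof -
  have g: "grad (\<lambda>\<xi>. f (\<xi>, \<nu>)) x \<bullet> a = f1 (x, \<nu>) (a, 0)" for \<nu> a
    by (rule inner_grad[OF twice_derivD(1)[OF twice_deriv_affine[OF f has_derivative_Pair_left]]])
  have "grad (\<lambda>\<xi>. f (\<xi>, \<nu>)) x = (\<Sum>c\<in>Basis. f1 (x, \<nu>) (c, 0) *\<^sub>R c)" for \<nu>
    by (subst euclidean_representation[symmetric]) (simp add: g)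
  moreover have "((\<lambda>\<nu>. \<Sum>c\<in>Basis. f1 (x, \<nu>) (c, 0) *\<^sub>R c) has_derivative
      (\<lambda>b. \<Sum>c\<in>Basis. f2 (x, u) (0, b) (c, 0) *\<^sub>R c)) (at u)"
    by (intro has_derivative_sum has_derivative_scaleR_left
        has_derivative_compose[OF has_derivative_Pair_right twice_derivD(2)[OF f]])
  ultimately have "hess_xu f x u *v b = (\<Sum>c\<in>Basis. f2 (x, u) (0, b) (c, 0) *\<^sub>R c)"
    unfolding hess_xu_def by (simp add: jacobian_mult)
  then have "(hess_xu f x u *v b) \<bullet> a = (\<Sum>c\<in>Basis. (a \<bullet> c) * f2 (x, u) (0, b) (c, 0))"
    by (simp add: inner_sum_left inner_commute[of a] mult.commute)
  also have "\<dots> = (\<Sum>c\<in>Basis. f2 (x, u) (0, b) ((a \<bullet> c) *\<^sub>R (c, 0)))"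
    using twice_deriv_linear(3)[OF f] by (simp add: linear_scale del: scaleR_Pair)
  also have "\<dots> = f2 (x, u) (0, b) (\<Sum>c\<in>Basis. (a \<bullet> c) *\<^sub>R (c, 0))"
    using twice_deriv_linear(3)[OF f] by (simp add: linear_sum del: scaleR_Pair)
  also have "(\<Sum>c\<in>Basis. (a \<bullet> c) *\<^sub>R (c, 0 :: real^'m)) = (a, 0)"
    by (simp add: sum_prod euclidean_representation)
  finally show ?thesis .
qed

lemma inner_weighted_sum:
  fixes a :: "real^'q" and M :: "'q \<Rightarrow> real^'n^'m"
  assumes "\<And>m. (M m *v u) \<bullet> v = d $ m"
  shows "((\<Sum>m\<in>UNIV. (a $ m) *\<^sub>R M m) *v u) \<bullet> v = a \<bullet> d"
proof -
  have "(\<Sum>m\<in>A. (a $ m) *\<^sub>R M m) *v u = (\<Sum>m\<in>A. (a $ m) *\<^sub>R (M m *v u))" if "finite A" for A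
    using that by induction (simp_all add: matrix_vector_mult_add_rdistrib scaleR_matrix_vector_assoc)
  then have "((\<Sum>m\<in>UNIV. (a $ m) *\<^sub>R M m) *v u) \<bullet> v = (\<Sum>m\<in>UNIV. (a $ m) *\<^sub>R (M m *v u)) \<bullet> v"
    by simp
  also have "\<dots> = (\<Sum>m\<in>UNIV. a $ m * d $ m)"
    unfolding inner_sum_left inner_scaleR_left assms ..
  finally show ?thesis by (simp add: inner_vec_def)
qed

lemma inner_whess:
  assumes f: "twice_deriv \<phi> f1 f2"
  shows "(whess a \<phi> x *v u) \<bullet> v = a \<bullet> f2 x u v"
  unfolding whess_def
  by (rule inner_weighted_sum) (rule inner_hess[OF twice_deriv_compose_linear[OF bounded_linear_vec_nth f]])

lemma inner_whess_xu:
  assumes f: "twice_deriv \<phi> f1 f2"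
  shows "(whess_xu a \<phi> x u *v b) \<bullet> c = a \<bullet> f2 (x, u) (0, b) (c, 0)"
  unfolding whess_xu_def
  by (rule inner_weighted_sum) (rule inner_hess_xu[OF twice_deriv_compose_linear[OF bounded_linear_vec_nth f]])

section \<open>Matrix identities for one stage\<close>

text \<open>Matrix identities are checked on vectors: products become nested applications, and what
  remains is additive algebra without noncommuting factors.\<close>

lemmas matrix_vector_expand = matrix_vector_mul_assoc[symmetric] matrix_vector_mult_add_rdistrib
  matrix_vector_mult_diff_rdistrib matrix_vector_right_distrib matrix_vector_mult_diff_distrib
  scaleR_matrix_vector_assoc[symmetric] matrix_vector_mult_scaleR

lemma minus_matrix_vector_mult: "(- A) *v x = - (A *v (x::real^'n))"
  using matrix_vector_mult_diff_rdistrib[of 0 A x] by simp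

lemma matrix_vector_mult_minus_right: "A *v (- x) = - (A *v (x::real^'n))"
  using matrix_vector_mult_diff_distrib[of A 0 x] by simp

lemma inner_transpose_mult:
  fixes A :: "real^'n^'m"
  shows "(transpose A *v x) \<bullet> y = x \<bullet> (A *v y)"
  by (simp add: dot_lmul_matrix[symmetric])

lemma transpose_scaleR_matrix: "transpose (c *\<^sub>R (A::real^'n^'m)) = c *\<^sub>R transpose A"
  by (simp add: transpose_def vec_eq_iff)

lemma transpose_plus: "transpose ((A::real^'n^'m) + B) = transpose A + transpose B"
  by (simp add: transpose_def vec_eq_iff)

lemma transpose_minus: "transpose ((A::real^'n^'m) - B) = transpose A - transpose B"
  by (simp add: transpose_def vec_eq_iff)

lemma symmetric_matrixI:
  fixes A :: "real^'n^'n"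
  assumes "\<And>u v. (A *v u) \<bullet> v = (A *v v) \<bullet> u"
  shows "transpose A = A"
proof -
  have "(transpose A *v u) \<bullet> v = (A *v u) \<bullet> v" for u v
    using assms[of u v] unfolding inner_transpose_mult by (simp only: inner_commute[of u])
  then have "transpose A *v u = A *v u" for u using vector_eq_rdot by blast
  then show ?thesis by (simp add: matrix_eq)
qed

lemma transpose_matrix_inv:
  fixes A :: "real^'n^'n"
  assumes "invertible A"
  shows "matrix_inv (transpose A) = transpose (matrix_inv A)"
proof -
  have "transpose (matrix_inv A) ** transpose A = mat 1"
    by (simp only: matrix_transpose_mul[symmetric] matrix_inv_cancel[OF assms] transpose_mat)
  then have "transpose (matrix_inv A) ** (transpose A ** matrix_inv (transpose A)) = matrix_inv (transpose A)"
    by (simp add: matrix_mul_assoc)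
  then show ?thesis
    by (simp add: matrix_inv_cancel[OF transpose_invertible[OF assms]])
qed

lemma sym_posdef_invertible:
  assumes "sym_posdef A"
  shows "invertible A"
proof -
  have "x = 0" if "A *v x = 0" for x
    using assms that unfolding sym_posdef_def by force
  then have "\<exists>B. B ** A = mat 1" by (simp add: matrix_left_invertible_ker)
  then show ?thesis by (simp add: invertible_left_inverse)
qed

lemma sym_posdef_inv:
  assumes "sym_posdef A"
  shows "transpose (matrix_inv A) = matrix_inv A"
  using transpose_matrix_inv[OF sym_posdef_invertible[OF assms]] assms by (simp add: sym_posdef_def)

lemma transpose_congruence:
  fixes W :: "real^'a^'a" and A :: "real^'b^'a" and B :: "real^'c^'a"
  assumes "transpose W = W"
  shows "transpose (transpose A ** W ** B) = transpose B ** W ** A"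
  by (simp only: matrix_transpose_mul transpose_transpose assms matrix_mul_assoc)

lemma inv_sym_inner:
  assumes "sym_posdef A"
  shows "x \<bullet> (matrix_inv A *v y) = y \<bullet> (matrix_inv A *v x)"
  using inner_transpose_mult[of "matrix_inv A" x y] sym_posdef_inv[OF assms] by (simp add: inner_commute)

lemma weight_inv:
  assumes "sym_posdef A"
  shows "(x v* matrix_inv A) \<bullet> y = y \<bullet> (matrix_inv A *v x)"
  using inv_sym_inner[OF assms] by (simp only: dot_lmul_matrix)

text \<open>Besides \<open>P ** F' ** matrix_inv R = K\<close> this rests on the Woodbury identity for the inverse
  of \<open>Q + F ** matrix_inv A ** F'\<close>. The hypothesis on \<open>x\<close> is the
  equation solved in the backward pass.\<close>

lemma kalman_update:
  fixes Q F F' A E Pbar P :: "real^'n^'n" and H :: "real^'n^'q" and H' K :: "real^'q^'n"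
    and R S :: "real^'q^'q" and x x' m m' w d :: "real^'n" and \<gamma> :: "real^'q"
  assumes inv: "invertible Q" "invertible R" "invertible A" "invertible E" "invertible S" "invertible P"
    and E: "E = A + F' ** matrix_inv Q ** F"
    and Pbar: "Pbar = Q + F ** matrix_inv A ** F'"
    and S: "S = R + H ** Pbar ** H'"
    and K: "K = Pbar ** H' ** matrix_inv S"
    and P: "P = (mat 1 - K ** H) ** Pbar"
    and m': "m' = (mat 1 - K ** H) *v (F *v m - w) + K *v \<gamma> + (P ** matrix_inv Q ** F ** matrix_inv E) *v d"
    and x: "E *v x = (F' ** matrix_inv Q) *v (w + x') + A *v m + d"
  shows "matrix_inv P *v (x' - m') =
    matrix_inv Q *v (x' + w - F *v x) - H' *v (matrix_inv R *v (\<gamma> - H *v x'))"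
proof -
  note cancel = inv[THEN matrix_inv_cancel_vector(1)] inv[THEN matrix_inv_cancel_vector(2)]
  \<comment> \<open>Expanding \<open>S\<close> in \<open>K ** S = Pbar ** H'\<close> isolates
    \<open>K\<close>, and the remaining terms form \<open>(mat 1 - K ** H) ** Pbar\<close>, which is
    \<open>P\<close>.\<close>
  have PH: "P *v (H' *v (matrix_inv R *v y)) = K *v y" for y
  proof -
    let ?r = "matrix_inv R *v y"
    have "K *v (S *v ?r) = Pbar *v (H' *v ?r)"
      by (simp add: K matrix_vector_expand cancel)
    moreover have "S *v ?r = y + H *v (Pbar *v (H' *v ?r))"
      by (simp add: S matrix_vector_expand cancel)
    ultimately show ?thesis
      by (simp add: P matrix_vector_expand algebra_simps)
  qed
  \<comment> \<open>The vector \<open>s\<close> below solves \<open>E s = F' Q^-1 y\<close>.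
    Splitting \<open>E\<close> turns this into \<open>A s = F' Q^-1 (y - F s)\<close>, so the second
    summand of \<open>Pbar\<close> contributes exactly \<open>F s\<close>.\<close>
  have woodbury: "Pbar *v (matrix_inv Q *v (y - F *v (matrix_inv E *v (F' *v (matrix_inv Q *v y))))) = y" for y
  proof -
    define s where "s = matrix_inv E *v (F' *v (matrix_inv Q *v y))"
    have "E *v s = F' *v (matrix_inv Q *v y)" by (simp add: s_def cancel)
    then have "A *v s = F' *v (matrix_inv Q *v (y - F *v s))"
      by (simp add: E matrix_vector_expand algebra_simps)
    then have "matrix_inv A *v (F' *v (matrix_inv Q *v (y - F *v s))) = s"
      by (metis cancel(3))
    then have "Pbar *v (matrix_inv Q *v (y - F *v s)) = y"
      by (simp add: Pbar matrix_vector_mult_add_rdistrib matrix_vector_mul_assoc[symmetric] cancel)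
    then show ?thesis by (simp add: s_def)
  qed
  \<comment> \<open>\<open>y\<close> is the deviation of \<open>x'\<close> from the prediction
    \<open>F *v m - w\<close>; the equation for \<open>x\<close> becomes
    \<open>x = m + s + E^-1 d\<close>.\<close>
  define y where "y = x' + w - F *v m"
  define s where "s = matrix_inv E *v (F' *v (matrix_inv Q *v y))"
  have "E *v x = E *v (m + s + matrix_inv E *v d)"
    by (simp add: x s_def y_def matrix_vector_right_distrib cancel) (simp add: E matrix_vector_expand algebra_simps)
  then have "x = m + s + matrix_inv E *v d" by (metis cancel(4))
  then have "x' + w - F *v x + F *v (matrix_inv E *v d) = y - F *v s"
    by (simp add: y_def matrix_vector_expand algebra_simps)
  then have "Pbar *v (matrix_inv Q *v (x' + w - F *v x + F *v (matrix_inv E *v d))) = y"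
    using woodbury[of y] by (simp add: s_def)
  \<comment> \<open>Applying \<open>mat 1 - K ** H\<close> to the predicted equation replaces
    \<open>Pbar\<close> by \<open>P\<close>; the measurement is added afterwards through
    \<open>PH\<close>.\<close>
  then have "P *v (matrix_inv Q *v (x' + w - F *v x + F *v (matrix_inv E *v d))) = y - K *v (H *v y)"
    by (simp add: P matrix_vector_mult_diff_rdistrib matrix_vector_mul_assoc[symmetric])
  then have "P *v (matrix_inv Q *v (x' + w - F *v x)) + P *v (matrix_inv Q *v (F *v (matrix_inv E *v d)))
      = y - K *v (H *v y)"
    by (simp only: matrix_vector_right_distrib)
  then have "P *v (matrix_inv Q *v (x' + w - F *v x) - H' *v (matrix_inv R *v (\<gamma> - H *v x'))) = x' - m'"
    unfolding matrix_vector_mult_diff_distrib[of P] PH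
    by (simp add: m' y_def matrix_vector_expand algebra_simps)
  then show ?thesis by (metis cancel(6))
qed

text \<open>This is the push-through identity: \<open>V (1 - c Q V) = (1 - c V Q) V\<close>, where
  the two brackets are transposes of each other.\<close>

lemma costate_symmetric:
  fixes V Q :: "real^'n^'n"
  assumes V: "transpose V = V" and Q: "transpose Q = Q" and inv: "invertible (mat 1 - c *\<^sub>R (V ** Q))"
  shows "transpose (matrix_inv (mat 1 - c *\<^sub>R (V ** Q)) ** V) = matrix_inv (mat 1 - c *\<^sub>R (V ** Q)) ** V"
proof -
  let ?G = "mat 1 - c *\<^sub>R (V ** Q)"
  have tG: "transpose ?G = mat 1 - c *\<^sub>R (Q ** V)"
    by (simp add: transpose_minus transpose_scaleR_matrix matrix_transpose_mul V Q transpose_mat)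
  have "V ** transpose ?G = ?G ** V"
    unfolding tG by (simp add: matrix_eq matrix_vector_expand)
  then have "matrix_inv ?G ** (V ** transpose ?G) ** matrix_inv (transpose ?G)
      = matrix_inv ?G ** (?G ** V) ** matrix_inv (transpose ?G)"
    by (rule arg_cong)
  moreover have "matrix_inv ?G ** (V ** transpose ?G) ** matrix_inv (transpose ?G) = matrix_inv ?G ** V"
    by (simp only: matrix_mul_assoc[symmetric] matrix_inv_cancel[OF transpose_invertible[OF inv]] matrix_mul_rid)
  moreover have "matrix_inv ?G ** (?G ** V) ** matrix_inv (transpose ?G) = V ** matrix_inv (transpose ?G)"
    by (simp only: matrix_mul_assoc matrix_inv_cancel[OF inv] matrix_mul_lid)
  ultimately have "matrix_inv ?G ** V = V ** matrix_inv (transpose ?G)" by simp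
  then show ?thesis
    by (simp add: matrix_transpose_mul V transpose_matrix_inv[OF inv])
qed

text \<open>Clearing the inverse leaves an implicit equation: \<open>x\<close> departs from
  \<open>f\<close> by \<open>c * Q\<close> times its own costate \<open>V *v x + v\<close>.
  Multiplying by \<open>V\<close> and collecting the costate reconciles the inverse of
  \<open>1 - c Q V\<close> in the forward pass with that of \<open>1 - c V Q\<close> in the backward
  pass.\<close>

lemma costate_eq:
  fixes V Q :: "real^'n^'n" and x f v :: "real^'n"
  assumes inv: "invertible (mat 1 - c *\<^sub>R (V ** Q))" "invertible (mat 1 - c *\<^sub>R (Q ** V))"
    and x: "x = matrix_inv (mat 1 - c *\<^sub>R (Q ** V)) *v (f + c *\<^sub>R (Q *v v))"
  shows "x = f + c *\<^sub>R (Q *v (V *v x + v))"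
    and "V *v x + v = matrix_inv (mat 1 - c *\<^sub>R (V ** Q)) *v (V *v f + v)"
proof -
  have "(mat 1 - c *\<^sub>R (Q ** V)) *v x = f + c *\<^sub>R (Q *v v)"
    unfolding x by (rule matrix_inv_cancel_vector(2)[OF inv(2)])
  then show 1: "x = f + c *\<^sub>R (Q *v (V *v x + v))"
    by (simp add: matrix_vector_expand algebra_simps)
  have "V *v x = V *v f + c *\<^sub>R (V *v (Q *v (V *v x + v)))"
    by (subst 1) (simp add: matrix_vector_expand)
  then have "(mat 1 - c *\<^sub>R (V ** Q)) *v (V *v x + v) = V *v f + v"
    by (simp add: matrix_vector_expand algebra_simps)
  then show "V *v x + v = matrix_inv (mat 1 - c *\<^sub>R (V ** Q)) *v (V *v f + v)"
    by (metis matrix_inv_cancel_vector(1)[OF inv(1)])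
qed

section \<open>Symmetry and costates along the passes\<close>

text \<open>\<open>C2\<close> provides derivatives only existentially; as parameters of the locale
  they can be used to write down variations.\<close>

locale ocp_twice =
  fixes pb :: "('n::finite, 'm::finite, 'q::finite) ocp"
    and c1 c2 d1 d2 m1 m2 t1 t2
  assumes setting: "ocp_setting pb"
    and cost_deriv: "k < hor pb \<Longrightarrow> twice_deriv (cost pb k) (c1 k) (c2 k)"
    and dyn_deriv: "k < hor pb \<Longrightarrow> twice_deriv (dyn pb k) (d1 k) (d2 k)"
    and meas_deriv: "1 \<le> k \<Longrightarrow> k \<le> cur pb \<Longrightarrow> twice_deriv (meas pb k) (m1 k) (m2 k)"
    and tcost_deriv: "twice_deriv (tcost pb) t1 t2"
begin

lemma mu_pos: "0 < mu pb"
  and cur_le_hor: "cur pb \<le> hor pb"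
  and pcov: "sym_posdef (pcov pb)"
  and qcov: "k < hor pb \<Longrightarrow> sym_posdef (qcov pb (k + 1))"
  and mcov: "1 \<le> k \<Longrightarrow> k \<le> cur pb \<Longrightarrow> sym_posdef (mcov pb k)"
  using setting by (auto simp: ocp_setting_def)

end

locale ocp_iterate = ocp_twice pb c1 c2 d1 d2 m1 m2 t1 t2
  for pb :: "('n::finite, 'm::finite, 'q::finite) ocp" and c1 c2 d1 d2 m1 m2 t1 t2 +
  fixes X :: "nat \<Rightarrow> real^'n" and U :: "nat \<Rightarrow> real^'m"
begin

lemma fx_mult: "k < hor pb \<Longrightarrow> fx pb X U k *v a = d1 k (X k, U k) (a, 0)"
  unfolding fx_def
  by (rule jacobian_mult[OF twice_derivD(1)[OF twice_deriv_affine[OF dyn_deriv has_derivative_Pair_left]]])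

lemma fu_mult: "k < hor pb \<Longrightarrow> fu pb X U k *v b = d1 k (X k, U k) (0, b)"
  unfolding fu_def
  by (rule jacobian_mult[OF twice_derivD(1)[OF twice_deriv_affine[OF dyn_deriv has_derivative_Pair_right]]])

lemma hx_mult: "1 \<le> k \<Longrightarrow> k \<le> cur pb \<Longrightarrow> hx pb X k *v a = m1 k (X k) a"
  unfolding hx_def by (rule jacobian_mult[OF twice_derivD(1)[OF meas_deriv]])

lemma dyn_deriv_eq:
  assumes "k < hor pb"
  shows "d1 k (X k, U k) (a, b) = fx pb X U k *v a + fu pb X U k *v b"
  using linear_add[OF twice_deriv_linear(1)[OF dyn_deriv[OF assms]], of "(X k, U k)" "(a, 0)" "(0, b)"]
  by (simp add: fx_mult fu_mult assms)

lemma cost_deriv_eq: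
  assumes "k < hor pb"
  shows "c1 k (X k, U k) (a, b) = lx pb X U k \<bullet> a + lu pb X U k \<bullet> b"
proof -
  have "lx pb X U k \<bullet> a = c1 k (X k, U k) (a, 0)"
    unfolding lx_def using assms
    by (simp add: inner_grad[OF twice_derivD(1)[OF twice_deriv_affine[OF cost_deriv[OF assms] has_derivative_Pair_left]]])
  moreover have "lu pb X U k \<bullet> b = c1 k (X k, U k) (0, b)"
    unfolding lu_def
    by (simp add: inner_grad[OF twice_derivD(1)[OF twice_deriv_affine[OF cost_deriv[OF assms] has_derivative_Pair_right]]])
  ultimately show ?thesis
    using linear_add[OF twice_deriv_linear(1)[OF cost_deriv[OF assms]], of "(X k, U k)" "(a, 0)" "(0, b)"]
    by simp
qed

lemma tcost_deriv_eq: "t1 (X (hor pb)) a = lx pb X U (hor pb) \<bullet> a"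
  by (simp add: lx_def inner_grad[OF twice_derivD(1)[OF tcost_deriv]])

lemma meas_curv_form:
  assumes "1 \<le> k" "k \<le> cur pb"
  shows "(meas_curv pb X k *v u) \<bullet> v = m2 k (X k) u v \<bullet> (matrix_inv (mcov pb k) *v \<gamma> pb X k) / mu pb"
  using assms
  by (simp add: meas_curv_def scaleR_matrix_vector_assoc[symmetric] inner_whess[OF meas_deriv] weight_inv[OF mcov])

text \<open>The second derivative of a stage Hamiltonian: the stage cost plus the dynamics weighted
  by the multiplier \<open>Q^-1 w / mu\<close>. The matrices \<open>lbar_xx\<close>,
  \<open>lbar_xu\<close>, \<open>lbar_ux\<close>, \<open>lbar_uu\<close> are its blocks, up to the
  measurement curvature in \<open>lbar_xx\<close>.\<close>

definition stage_form :: "nat \<Rightarrow> (real^'n) \<times> (real^'m) \<Rightarrow> (real^'n) \<times> (real^'m) \<Rightarrow> real"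
  where "stage_form k \<xi> \<eta> = c2 k (X k, U k) \<xi> \<eta>
    + d2 k (X k, U k) \<xi> \<eta> \<bullet> (matrix_inv (qcov pb (k + 1)) *v w pb X U (k + 1)) / mu pb"

lemma stage_form_sym:
  assumes "k < hor pb"
  shows "stage_form k \<xi> \<eta> = stage_form k \<eta> \<xi>"
  unfolding stage_form_def
  using twice_deriv_symmetric[OF cost_deriv[OF assms], of "(X k, U k)" \<xi> \<eta>] twice_deriv_symmetric[OF dyn_deriv[OF assms], of "(X k, U k)" \<xi> \<eta>]
  by simp

lemma stage_form_add:
  assumes "k < hor pb"
  shows "stage_form k (\<xi> + \<xi>') \<eta> = stage_form k \<xi> \<eta> + stage_form k \<xi>' \<eta>"
  unfolding stage_form_def
  by (simp add: linear_add[OF twice_deriv_linear(2)[OF cost_deriv[OF assms]]]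
      linear_add[OF twice_deriv_linear(2)[OF dyn_deriv[OF assms]]] inner_add_left add_divide_distrib)

lemma lbar_xx_form:
  assumes "k < hor pb"
  shows "(lbar_xx pb X U k *v p) \<bullet> a = stage_form k (p, 0) (a, 0) + (meas_curv pb X k *v p) \<bullet> a"
  unfolding lbar_xx_def stage_form_def
  by (simp add: matrix_vector_mult_add_rdistrib inner_add_left scaleR_matrix_vector_assoc[symmetric]
      inner_hess[OF twice_deriv_affine[OF cost_deriv[OF assms] has_derivative_Pair_left]]
      inner_whess[OF twice_deriv_affine[OF dyn_deriv[OF assms] has_derivative_Pair_left]]
      weight_inv[OF qcov[OF assms], simplified])

lemma lbar_uu_form:
  assumes "k < hor pb"
  shows "(lbar_uu pb X U k *v q) \<bullet> b = stage_form k (0, q) (0, b)"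
  unfolding lbar_uu_def stage_form_def
  by (simp add: matrix_vector_mult_add_rdistrib inner_add_left scaleR_matrix_vector_assoc[symmetric]
      inner_hess[OF twice_deriv_affine[OF cost_deriv[OF assms] has_derivative_Pair_right]]
      inner_whess[OF twice_deriv_affine[OF dyn_deriv[OF assms] has_derivative_Pair_right]]
      weight_inv[OF qcov[OF assms], simplified])

lemma lbar_xu_form:
  assumes "k < hor pb"
  shows "(lbar_xu pb X U k *v q) \<bullet> a = stage_form k (0, q) (a, 0)"
  unfolding lbar_xu_def stage_form_def
  by (simp add: matrix_vector_mult_add_rdistrib inner_add_left scaleR_matrix_vector_assoc[symmetric]
      inner_hess_xu[OF cost_deriv[OF assms]] inner_whess_xu[OF dyn_deriv[OF assms]]
      weight_inv[OF qcov[OF assms], simplified])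

lemma lbar_ux_form:
  assumes "k < hor pb"
  shows "(lbar_ux pb X U k *v p) \<bullet> b = stage_form k (p, 0) (0, b)"
  unfolding lbar_ux_def inner_transpose_mult
  using lbar_xu_form[OF assms, of b p] stage_form_sym[OF assms] by (simp add: inner_commute)

lemma stage_form_eq:
  assumes "k < hor pb"
  shows "stage_form k (p, q) (a, b) + (meas_curv pb X k *v p) \<bullet> a =
    (lbar_xx pb X U k *v p + lbar_xu pb X U k *v q) \<bullet> a + (lbar_ux pb X U k *v p + lbar_uu pb X U k *v q) \<bullet> b"
proof -
  have "stage_form k \<xi> (a, b) = stage_form k \<xi> (a, 0) + stage_form k \<xi> (0, b)" for \<xi>
    using stage_form_add[OF assms, of "(a, 0)" "(0, b)" \<xi>] by (simp add: stage_form_sym[OF assms, of \<xi>])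
  then show ?thesis
    using stage_form_add[OF assms, of "(p, 0)" "(0, q)" "(a, b)"]
    by (simp add: inner_add_left lbar_xx_form lbar_xu_form lbar_ux_form lbar_uu_form assms)
qed

lemma meas_curv_sym: "(meas_curv pb X k *v u) \<bullet> v = (meas_curv pb X k *v v) \<bullet> u"
proof (cases "1 \<le> k \<and> k \<le> cur pb")
  case True
  then show ?thesis
    using twice_deriv_symmetric[OF meas_deriv, of k "X k" u v] by (simp add: meas_curv_form)
next
  case False
  then show ?thesis by (auto simp: meas_curv_def)
qed

lemma transpose_lbar_xx: "k < hor pb \<Longrightarrow> transpose (lbar_xx pb X U k) = lbar_xx pb X U k"
  by (rule symmetric_matrixI)
    (simp only: lbar_xx_form, rule arg_cong2[where f = "(+)", OF stage_form_sym meas_curv_sym])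

lemma transpose_lbar_uu: "k < hor pb \<Longrightarrow> transpose (lbar_uu pb X U k) = lbar_uu pb X U k"
  by (rule symmetric_matrixI) (simp only: lbar_uu_form, rule stage_form_sym)

lemma transpose_terminal:
  "transpose (hess (tcost pb) (X (hor pb)) + meas_curv pb X (hor pb)) = hess (tcost pb) (X (hor pb)) + meas_curv pb X (hor pb)"
proof (rule symmetric_matrixI)
  fix u v
  show "((hess (tcost pb) (X (hor pb)) + meas_curv pb X (hor pb)) *v u) \<bullet> v
      = ((hess (tcost pb) (X (hor pb)) + meas_curv pb X (hor pb)) *v v) \<bullet> u"
    using meas_curv_sym[of "hor pb" u v] twice_deriv_symmetric[OF tcost_deriv, of "X (hor pb)" u v]
    by (simp add: matrix_vector_mult_add_rdistrib inner_add_left inner_hess[OF tcost_deriv])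
qed

end

locale ocp_pass = ocp_iterate pb c1 c2 d1 d2 m1 m2 t1 t2 X U
  for pb :: "('n::finite, 'm::finite, 'q::finite) ocp" and c1 c2 d1 d2 m1 m2 t1 t2
    and X :: "nat \<Rightarrow> real^'n" and U :: "nat \<Rightarrow> real^'m" +
  assumes wd: "pass_well_defined pb X U"
begin

lemma wd_ctl:
  assumes "cur pb \<le> k" "k < hor pb"
  shows "invertible (Gam pb k (Vmat pb X U (k + 1)))"
    and "invertible (Quu pb X U k (Vmat pb X U (k + 1)))"
    and "invertible (mat 1 - mu pb *\<^sub>R (qcov pb (k + 1) ** Vmat pb X U (k + 1)))"
  using wd assms unfolding pass_well_defined_def by auto

lemma wd_est:
  shows "k \<le> cur pb \<Longrightarrow> invertible (Pest pb X U k)"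
    and "k < cur pb \<Longrightarrow> invertible (Emat pb X U k)"
    and "k < cur pb \<Longrightarrow> invertible (matrix_inv (Pest pb X U k) - mu pb *\<^sub>R lbar_xx pb X U k)"
    and "k < cur pb \<Longrightarrow> invertible (mcov pb (k + 1)
           + hx pb X (k + 1) ** Pbar_step pb X U k (Pest pb X U k) ** transpose (hx pb X (k + 1)))"
    and "invertible (matrix_inv (Pest pb X U (cur pb)) - mu pb *\<^sub>R Vmat pb X U (cur pb))"
  using wd unfolding pass_well_defined_def by auto

lemma qcov_sym: "k < hor pb \<Longrightarrow> transpose (qcov pb (k + 1)) = qcov pb (k + 1)"
  using qcov by (simp add: sym_posdef_def)

section \<open>Symmetry of the control backward pass\<close>

lemma Gam_sym:
  assumes "cur pb \<le> k" "k < hor pb" and V: "transpose (Vmat pb X U (k + 1)) = Vmat pb X U (k + 1)"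
  shows "transpose (matrix_inv (Gam pb k (Vmat pb X U (k + 1))) ** Vmat pb X U (k + 1))
    = matrix_inv (Gam pb k (Vmat pb X U (k + 1))) ** Vmat pb X U (k + 1)"
  unfolding Gam_def
  by (rule costate_symmetric[OF V qcov_sym wd_ctl(1)[unfolded Gam_def]]) (use assms in auto)

lemma transpose_Quu:
  assumes "cur pb \<le> k" "k < hor pb" and V: "transpose (Vmat pb X U (k + 1)) = Vmat pb X U (k + 1)"
  shows "transpose (Quu pb X U k (Vmat pb X U (k + 1))) = Quu pb X U k (Vmat pb X U (k + 1))"
  unfolding Quu_def
  using transpose_congruence[OF Gam_sym[OF assms], of "fu pb X U k" "fu pb X U k"]
  by (simp only: transpose_plus matrix_mul_assoc transpose_lbar_uu[OF assms(2)])

text \<open>The recursions for \<open>Vmat\<close> and \<open>vvec\<close> contain the transpose of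
  \<open>Qux\<close>, the Newton equation in the state contains \<open>lbar_xu\<close>; symmetry of
  \<open>V\<close> connects the two.\<close>

lemma transpose_Qux:
  assumes "cur pb \<le> k" "k < hor pb" and V: "transpose (Vmat pb X U (k + 1)) = Vmat pb X U (k + 1)"
  shows "transpose (Qux pb X U k (Vmat pb X U (k + 1))) = lbar_xu pb X U k +
    transpose (fx pb X U k) ** matrix_inv (Gam pb k (Vmat pb X U (k + 1))) ** Vmat pb X U (k + 1) ** fu pb X U k"
  unfolding Qux_def lbar_ux_def
  using transpose_congruence[OF Gam_sym[OF assms], of "fu pb X U k" "fx pb X U k"]
  by (simp only: transpose_plus transpose_transpose matrix_mul_assoc)

text \<open>With the gain substituted, a backward step is a symmetric block plus a congruence of
  \<open>Gam^-1 V\<close>, minus a congruence of the inverse of \<open>Quu\<close>, as in a Schur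
  complement.\<close>

lemma transpose_Vmat:
  assumes "cur pb \<le> k" "k \<le> hor pb"
  shows "transpose (Vmat pb X U k) = Vmat pb X U k"
  using assms(2,1)
proof (induction k rule: inc_induct)
  case base
  show ?case using transpose_terminal by (subst (1 2) Vmat.simps) simp
next
  case (step k)
  then have k: "cur pb \<le> k" "k < hor pb" by auto
  let ?V = "Vmat pb X U (k + 1)"
  have V: "transpose ?V = ?V" using step by simp
  have "Vmat pb X U k = lbar_xx pb X U k
      + transpose (fx pb X U k) ** (matrix_inv (Gam pb k ?V) ** ?V) ** fx pb X U k
      - transpose (Qux pb X U k ?V) ** matrix_inv (Quu pb X U k ?V) ** Qux pb X U k ?V"
    using k by (subst Vmat.simps)
      (simp add: Let_def Gfb_def matrix_mul_assoc matrix_eq matrix_vector_mult_add_rdistrib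
        matrix_vector_mult_diff_rdistrib matrix_vector_mul_assoc[symmetric] minus_matrix_vector_mult
        matrix_vector_mult_minus_right)
  moreover have "transpose (matrix_inv (Quu pb X U k ?V)) = matrix_inv (Quu pb X U k ?V)"
    using transpose_matrix_inv[OF wd_ctl(2)[OF k]] transpose_Quu[OF k V] by simp
  ultimately show ?case
    by (simp only: transpose_plus transpose_minus transpose_congruence[OF Gam_sym[OF k V]]
        transpose_congruence transpose_lbar_xx[OF k(2)])
qed

text \<open>Up to sign the multiplier of the transition into stage \<open>k\<close>: for \<open>k > cur pb\<close> it is
  \<open>matrix_inv (qcov pb k) / mu pb\<close> applied to the residual of the linearised transition.\<close>

definition costate :: "nat \<Rightarrow> real^'n"
  where "costate k = Vmat pb X U k *v dir_x pb X U k + vvec pb X U k"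

text \<open>Both final passes start from \<open>pxt\<close>, so at the current time either formula
  may be used.\<close>

lemma dir_x_ctl:
  assumes "cur pb \<le> k"
  shows "dir_x pb X U k = px_ctl pb X U k"
proof (cases "k = cur pb")
  case True
  then show ?thesis by (cases "cur pb") (auto simp: dir_x_def px_est.simps)
qed (use assms in \<open>auto simp: dir_x_def\<close>)

text \<open>The discrete adjoint system on the control horizon: relaxed linearised dynamics,
  stationarity in the control, adjoint recursion. The first comes from \<open>costate_eq\<close>,
  the second from clearing the inverse of \<open>Quu\<close>, the third from unfolding
  \<open>Vmat\<close> and \<open>vvec\<close>.\<close>

lemma ctl_step:
  assumes k: "cur pb \<le> k" "k < hor pb"
  shows "w pb X U (k + 1) + dir_x pb X U (k + 1) - fx pb X U k *v dir_x pb X U k - fu pb X U k *v dir_u pb X U k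
      = mu pb *\<^sub>R (qcov pb (k + 1) *v costate (k + 1))"
    and "lu pb X U k + lbar_ux pb X U k *v dir_x pb X U k + lbar_uu pb X U k *v dir_u pb X U k
      + transpose (fu pb X U k) *v costate (k + 1) = 0"
    and "costate k = lx pb X U k + lbar_xx pb X U k *v dir_x pb X U k + lbar_xu pb X U k *v dir_u pb X U k
      + transpose (fx pb X U k) *v costate (k + 1)"
proof -
  let ?V = "Vmat pb X U (k + 1)" and ?v = "vvec pb X U (k + 1)" and ?p = "dir_x pb X U k"
    and ?q = "dir_u pb X U k" and ?F = "fx pb X U k" and ?B = "fu pb X U k" and ?w = "w pb X U (k + 1)"
  let ?G = "matrix_inv (Gam pb k ?V)"
  have V: "transpose ?V = ?V" using transpose_Vmat k by simp
  have "dir_x pb X U (k + 1) = matrix_inv (mat 1 - mu pb *\<^sub>R (qcov pb (k + 1) ** ?V)) *v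
      ((?F *v ?p + ?B *v ?q - ?w) + mu pb *\<^sub>R (qcov pb (k + 1) *v ?v))"
    using k by (simp add: dir_x_ctl[of "Suc k"] dir_x_ctl[of k] dir_u_def algebra_simps)
  note cs = costate_eq[OF wd_ctl(1)[OF k, unfolded Gam_def] wd_ctl(3)[OF k] this, folded Gam_def costate_def]
  show "?w + dir_x pb X U (k + 1) - ?F *v ?p - ?B *v ?q = mu pb *\<^sub>R (qcov pb (k + 1) *v costate (k + 1))"
    by (subst cs(1)) (simp add: algebra_simps)
  have co: "costate (k + 1) = ?G *v (?V *v (?F *v ?p)) + ?G *v (?V *v (?B *v ?q)) + ?G *v (?v - ?V *v ?w)"
    unfolding cs(2) by (simp add: matrix_vector_expand algebra_simps)
  have "?q = matrix_inv (Quu pb X U k ?V) *v (- (Qux pb X U k ?V *v ?p) - Qu pb X U k ?V ?v)"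
    unfolding dir_u_def[of pb X U k] pu_of_def Gfb_def gff_def
    by (simp add: minus_matrix_vector_mult matrix_vector_mul_assoc[symmetric] matrix_vector_mult_diff_distrib
        matrix_vector_mult_minus_right)
  then have "Quu pb X U k ?V *v ?q = - (Qux pb X U k ?V *v ?p) - Qu pb X U k ?V ?v"
    by (metis matrix_inv_cancel_vector(2)[OF wd_ctl(2)[OF k]])
  then have "Quu pb X U k ?V *v ?q + Qux pb X U k ?V *v ?p + Qu pb X U k ?V ?v = 0"
    by simp
  then show "lu pb X U k + lbar_ux pb X U k *v ?p + lbar_uu pb X U k *v ?q + transpose ?B *v costate (k + 1) = 0"
    unfolding co Quu_def Qux_def Qu_def
    by (simp add: matrix_vector_mult_add_rdistrib matrix_vector_mul_assoc[symmetric] matrix_vector_right_distrib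
        algebra_simps)
  \<comment> \<open>Feedback and feedforward enter \<open>Vmat\<close> and \<open>vvec\<close>
    separately; in the costate they recombine into the control step.\<close>
  have q: "Gfb pb X U k ?V *v ?p + gff pb X U k ?V ?v = ?q"
    by (simp add: dir_u_def pu_of_def)
  have "costate k = lbar_xx pb X U k *v ?p + transpose ?F *v (?G *v (?V *v (?F *v ?p)))
      + transpose (Qux pb X U k ?V) *v (Gfb pb X U k ?V *v ?p)
      + (lx pb X U k + transpose ?F *v (?G *v (?v - ?V *v ?w))
      + transpose (Qux pb X U k ?V) *v gff pb X U k ?V ?v)"
    unfolding costate_def using k
    by (subst Vmat.simps, subst vvec.simps)
      (simp add: Let_def matrix_vector_mult_add_rdistrib matrix_vector_mul_assoc[symmetric])
  also have "\<dots> = lbar_xx pb X U k *v ?p + transpose ?F *v (?G *v (?V *v (?F *v ?p)))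
      + (lx pb X U k + transpose ?F *v (?G *v (?v - ?V *v ?w)))
      + transpose (Qux pb X U k ?V) *v ?q"
    unfolding q[symmetric] by (simp add: matrix_vector_right_distrib)
  finally show "costate k = lx pb X U k + lbar_xx pb X U k *v ?p + lbar_xu pb X U k *v ?q
      + transpose ?F *v costate (k + 1)"
    unfolding co transpose_Qux[OF k V]
    by (simp add: matrix_vector_mult_add_rdistrib matrix_vector_mul_assoc[symmetric] matrix_vector_right_distrib
        algebra_simps)
qed

text \<open>The counterpart of \<open>mu pb *\<^sub>R costate k\<close> on the estimation horizon.\<close>

definition estate :: "nat \<Rightarrow> real^'n"
  where "estate k = matrix_inv (Pest pb X U k) *v (dir_x pb X U k - muhat pb X U k)"

lemma est_step:
  assumes k: "k < cur pb"
  shows "estate k = mu pb *\<^sub>R (lbar_xx pb X U k *v dir_x pb X U k + lx pb X U k) + transpose (fx pb X U k) *v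
      (matrix_inv (qcov pb (k + 1)) *v (dir_x pb X U (k + 1) + w pb X U (k + 1) - fx pb X U k *v dir_x pb X U k))"
    and "estate (k + 1) =
      matrix_inv (qcov pb (k + 1)) *v (dir_x pb X U (k + 1) + w pb X U (k + 1) - fx pb X U k *v dir_x pb X U k)
      - transpose (hx pb X (k + 1)) *v (matrix_inv (mcov pb (k + 1)) *v
          (\<gamma> pb X (k + 1) - hx pb X (k + 1) *v dir_x pb X U (k + 1)))"
proof -
  have kT: "k < hor pb" using k cur_le_hor by simp
  let ?P = "Pest pb X U k" and ?m = "muhat pb X U k" and ?p = "dir_x pb X U k"
  let ?A = "matrix_inv ?P - mu pb *\<^sub>R lbar_xx pb X U k"
  have "?p = matrix_inv (Emat pb X U k) *v
        ((transpose (fx pb X U k) ** matrix_inv (qcov pb (k + 1))) *v (w pb X U (k + 1) + dir_x pb X U (k + 1))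
         + matrix_inv ?P *v ?m + mu pb *\<^sub>R lx pb X U k)"
    using k by (simp add: dir_x_def px_est.simps[of pb X U k])
  then have E: "Emat pb X U k *v ?p =
        (transpose (fx pb X U k) ** matrix_inv (qcov pb (k + 1))) *v (w pb X U (k + 1) + dir_x pb X U (k + 1))
         + matrix_inv ?P *v ?m + mu pb *\<^sub>R lx pb X U k"
    by (metis matrix_inv_cancel_vector(2)[OF wd_est(2)[OF k]])
  then show "estate k = mu pb *\<^sub>R (lbar_xx pb X U k *v ?p + lx pb X U k) + transpose (fx pb X U k) *v
      (matrix_inv (qcov pb (k + 1)) *v (dir_x pb X U (k + 1) + w pb X U (k + 1) - fx pb X U k *v ?p))"
    unfolding estate_def Emat_def
    by (simp add: matrix_vector_expand algebra_simps)
  show "estate (k + 1) =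
      matrix_inv (qcov pb (k + 1)) *v (dir_x pb X U (k + 1) + w pb X U (k + 1) - fx pb X U k *v ?p)
      - transpose (hx pb X (k + 1)) *v (matrix_inv (mcov pb (k + 1)) *v
          (\<gamma> pb X (k + 1) - hx pb X (k + 1) *v dir_x pb X U (k + 1)))"
    unfolding estate_def
  \<comment> \<open>The curvature sits in \<open>?A\<close>, so \<open>d\<close> has to restore it:
    \<open>?A *v ?m + d\<close> is \<open>P^-1 m + mu lx\<close>, the right-hand side in the
    backward pass.\<close>
  proof (rule kalman_update[where A = ?A and F' = "transpose (fx pb X U k)" and E = "Emat pb X U k"
        and Pbar = "Pbar_step pb X U k ?P" and K = "K_step pb X U k ?P" and m = ?m
        and d = "mu pb *\<^sub>R (lbar_xx pb X U k *v ?m + lx pb X U k)"])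
    show "invertible (qcov pb (k + 1))" "invertible (mcov pb (k + 1))"
      using sym_posdef_invertible qcov[OF kT] mcov[of "k + 1"] k by auto
    show "invertible (Pest pb X U (k + 1))" by (rule wd_est(1)) (use k in simp)
    show "invertible ?A" "invertible (Emat pb X U k)"
      "invertible (mcov pb (k + 1) + hx pb X (k + 1) ** Pbar_step pb X U k ?P ** transpose (hx pb X (k + 1)))"
      using wd_est k by auto
    show "Emat pb X U k *v ?p =
        (transpose (fx pb X U k) ** matrix_inv (qcov pb (k + 1))) *v (w pb X U (k + 1) + dir_x pb X U (k + 1))
         + ?A *v ?m + mu pb *\<^sub>R (lbar_xx pb X U k *v ?m + lx pb X U k)"
      unfolding E by (simp add: matrix_vector_expand algebra_simps)
    show "muhat pb X U (k + 1) =
      (mat 1 - K_step pb X U k ?P ** hx pb X (k + 1)) *v (fx pb X U k *v ?m - w pb X U (k + 1))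
      + K_step pb X U k ?P *v \<gamma> pb X (k + 1)
      + (Pest pb X U (k + 1) ** matrix_inv (qcov pb (k + 1)) ** fx pb X U k ** matrix_inv (Emat pb X U k))
          *v (mu pb *\<^sub>R (lbar_xx pb X U k *v ?m + lx pb X U k))"
      unfolding matrix_vector_mult_scaleR by simp
  qed (simp_all add: Emat_def Pbar_step_def K_step_def)
qed

lemma estate_cur: "estate (cur pb) = mu pb *\<^sub>R costate (cur pb)"
proof -
  let ?P = "matrix_inv (Pest pb X U (cur pb))" and ?p = "dir_x pb X U (cur pb)"
  have "?p = pxt pb X U" by (simp add: dir_x_def px_est.simps)
  then have "(?P - mu pb *\<^sub>R Vmat pb X U (cur pb)) *v ?p
      = ?P *v muhat pb X U (cur pb) + mu pb *\<^sub>R vvec pb X U (cur pb)"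
    by (simp add: pxt_def matrix_inv_cancel_vector(2)[OF wd_est(5)])
  then show ?thesis
    unfolding estate_def costate_def by (simp add: matrix_vector_expand algebra_simps)
qed

end

section \<open>Newton direction\<close>

context ocp_iterate begin

text \<open>The sums run over all stages. For the fixed past controls the variation \<open>b\<close>
  is zero when this is applied, so both horizons share one formula.\<close>

definition first_var :: "(nat \<Rightarrow> real^'n) \<Rightarrow> (nat \<Rightarrow> real^'m) \<Rightarrow> real"
  where "first_var a b = (\<Sum>k<hor pb. c1 k (X k, U k) (a k, b k)) + t1 (X (hor pb)) (a (hor pb))
    - a 0 \<bullet> (matrix_inv (pcov pb) *v (X 0 - xprior pb)) / mu pb
    + (\<Sum>j=1..cur pb. m1 j (X j) (a j) \<bullet> (matrix_inv (mcov pb j) *v \<gamma> pb X j)) / mu pb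
    - (\<Sum>k<hor pb. (a (k + 1) - d1 k (X k, U k) (a k, b k)) \<bullet> (matrix_inv (qcov pb (k + 1)) *v w pb X U (k + 1))) / mu pb"

definition second_var :: "(nat \<Rightarrow> real^'n) \<Rightarrow> (nat \<Rightarrow> real^'m) \<Rightarrow> (nat \<Rightarrow> real^'n) \<Rightarrow> (nat \<Rightarrow> real^'m) \<Rightarrow> real"
  where "second_var p q a b = (\<Sum>k<hor pb. c2 k (X k, U k) (p k, q k) (a k, b k)) + t2 (X (hor pb)) (p (hor pb)) (a (hor pb))
    - a 0 \<bullet> (matrix_inv (pcov pb) *v p 0) / mu pb
    - (\<Sum>j=1..cur pb. m1 j (X j) (a j) \<bullet> (matrix_inv (mcov pb j) *v m1 j (X j) (p j))
        - m2 j (X j) (p j) (a j) \<bullet> (matrix_inv (mcov pb j) *v \<gamma> pb X j)) / mu pb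
    - (\<Sum>k<hor pb. (a (k + 1) - d1 k (X k, U k) (a k, b k)) \<bullet>
          (matrix_inv (qcov pb (k + 1)) *v (p (k + 1) - d1 k (X k, U k) (p k, q k)))
        - d2 k (X k, U k) (p k, q k) (a k, b k) \<bullet> (matrix_inv (qcov pb (k + 1)) *v w pb X U (k + 1))) / mu pb"

text \<open>The gradient of the measurement penalty plus the Gauss-Newton part of its Hessian
  applied to the step.\<close>

definition meas_term :: "(nat \<Rightarrow> real^'n) \<Rightarrow> nat \<Rightarrow> real^'n"
  where "meas_term p k = (if 1 \<le> k \<and> k \<le> cur pb
    then (1 / mu pb) *\<^sub>R (transpose (hx pb X k) *v (matrix_inv (mcov pb k) *v (\<gamma> pb X k - hx pb X k *v p k)))
    else 0)"

text \<open>The contribution of stage \<open>k\<close> to the linearised optimality condition tested with \<open>(a, b)\<close>. The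
  residual of the measurement of \<open>x\<^sub>k\<^sub>+\<^sub>1\<close> is counted here, its curvature in \<open>lbar_xx (k + 1)\<close>: with
  this split the stage terms telescope.\<close>

definition stage_term where
  "stage_term p q a b k = (lx pb X U k + lbar_xx pb X U k *v p k + lbar_xu pb X U k *v q k) \<bullet> a k
    + (lu pb X U k + lbar_ux pb X U k *v p k + lbar_uu pb X U k *v q k) \<bullet> b k
    - (matrix_inv (qcov pb (k + 1)) *v (w pb X U (k + 1) + p (k + 1) - fx pb X U k *v p k - fu pb X U k *v q k))
        \<bullet> (a (k + 1) - fx pb X U k *v a k - fu pb X U k *v b k) / mu pb
    + meas_term p (k + 1) \<bullet> a (k + 1)"

lemma variation_eq_stage_sum:
  "second_var p q a b + first_var a b = (\<Sum>k<hor pb. stage_term p q a b k)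
    + (lx pb X U (hor pb) + (hess (tcost pb) (X (hor pb)) + meas_curv pb X (hor pb)) *v p (hor pb)) \<bullet> a (hor pb)
    - a 0 \<bullet> (matrix_inv (pcov pb) *v (p 0 + X 0 - xprior pb)) / mu pb"
proof -
  let ?mc = "\<lambda>k. (meas_curv pb X k *v p k) \<bullet> a k" and ?mt = "\<lambda>k. meas_term p k \<bullet> a k"
  have meas: "m1 j (X j) (a j) \<bullet> (matrix_inv (mcov pb j) *v \<gamma> pb X j) / mu pb
      - (m1 j (X j) (a j) \<bullet> (matrix_inv (mcov pb j) *v m1 j (X j) (p j))
        - m2 j (X j) (p j) (a j) \<bullet> (matrix_inv (mcov pb j) *v \<gamma> pb X j)) / mu pb = ?mt j + ?mc j"
    if "j \<in> {1..cur pb}" for j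
  proof -
    have j: "1 \<le> j" "j \<le> cur pb" using that by auto
    have "?mt j = (matrix_inv (mcov pb j) *v (\<gamma> pb X j - m1 j (X j) (p j))) \<bullet> m1 j (X j) (a j) / mu pb"
      unfolding meas_term_def using j by (simp add: dot_lmul_matrix hx_mult)
    also have "\<dots> = (m1 j (X j) (a j) \<bullet> (matrix_inv (mcov pb j) *v \<gamma> pb X j)
        - m1 j (X j) (a j) \<bullet> (matrix_inv (mcov pb j) *v m1 j (X j) (p j))) / mu pb"
      by (simp add: matrix_vector_mult_diff_distrib inner_diff_right inner_commute[of _ "m1 j (X j) (a j)"])
    finally show ?thesis by (simp add: meas_curv_form[OF j] diff_divide_distrib)
  qed
  \<comment> \<open>\<open>meas_term\<close> vanishes after the current time; the extended sum is
    shifted by one, to charge the measurement of a state to the stage leading to it.\<close>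
  have "(\<Sum>j=1..cur pb. ?mt j) = (\<Sum>j=1..hor pb. ?mt j)"
    using cur_le_hor by (intro sum.mono_neutral_left) (auto simp: meas_term_def)
  also have "\<dots> = (\<Sum>k<hor pb. ?mt (k + 1))"
    by (simp add: sum.atLeast1_atMost_eq atLeast0LessThan)
  finally have mt: "(\<Sum>j=1..cur pb. ?mt j) = (\<Sum>k<hor pb. ?mt (k + 1))" .
  \<comment> \<open>\<open>meas_curv\<close> vanishes at index 0 and after the current time. The
    last state belongs to no stage, so its curvature joins the terminal cost.\<close>
  have "(\<Sum>j=1..cur pb. ?mc j) = (\<Sum>k\<in>{..hor pb}. ?mc k)"
    using cur_le_hor by (intro sum.mono_neutral_left) (auto simp: meas_curv_def)
  also have "\<dots> = (\<Sum>k<hor pb. ?mc k) + ?mc (hor pb)"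
    by (simp add: lessThan_Suc_atMost[symmetric])
  finally have mc: "(\<Sum>j=1..cur pb. ?mc j) = (\<Sum>k<hor pb. ?mc k) + ?mc (hor pb)" .
  have stage: "stage_term p q a b k = c1 k (X k, U k) (a k, b k) + c2 k (X k, U k) (p k, q k) (a k, b k)
      - (a (k + 1) - d1 k (X k, U k) (a k, b k)) \<bullet> (matrix_inv (qcov pb (k + 1)) *v w pb X U (k + 1)) / mu pb
      - ((a (k + 1) - d1 k (X k, U k) (a k, b k)) \<bullet>
          (matrix_inv (qcov pb (k + 1)) *v (p (k + 1) - d1 k (X k, U k) (p k, q k)))
        - d2 k (X k, U k) (p k, q k) (a k, b k) \<bullet> (matrix_inv (qcov pb (k + 1)) *v w pb X U (k + 1))) / mu pb
      + ?mc k + ?mt (k + 1)" if "k \<in> {..<hor pb}" for k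
  proof -
    have k: "k < hor pb" using that by simp
    let ?Q = "matrix_inv (qcov pb (k + 1))" and ?a = "a (k + 1) - fx pb X U k *v a k - fu pb X U k *v b k"
      and ?p = "p (k + 1) - fx pb X U k *v p k - fu pb X U k *v q k"
    have "w pb X U (k + 1) + p (k + 1) - fx pb X U k *v p k - fu pb X U k *v q k = w pb X U (k + 1) + ?p"
      by simp
    then have 1: "(?Q *v (w pb X U (k + 1) + p (k + 1) - fx pb X U k *v p k - fu pb X U k *v q k)) \<bullet> ?a
        = ?a \<bullet> (?Q *v w pb X U (k + 1)) + ?a \<bullet> (?Q *v ?p)"
      by (simp only: matrix_vector_right_distrib inner_add_right inner_commute[of _ ?a])
    have 2: "a (k + 1) - d1 k (X k, U k) (a k, b k) = ?a" "p (k + 1) - d1 k (X k, U k) (p k, q k) = ?p"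
      by (simp_all add: dyn_deriv_eq[OF k] algebra_simps)
    have 3: "(lx pb X U k + lbar_xx pb X U k *v p k + lbar_xu pb X U k *v q k) \<bullet> a k
        + (lu pb X U k + lbar_ux pb X U k *v p k + lbar_uu pb X U k *v q k) \<bullet> b k
        = c1 k (X k, U k) (a k, b k) + stage_form k (p k, q k) (a k, b k) + ?mc k"
      using stage_form_eq[OF k, of "p k" "q k" "a k" "b k"]
      by (simp add: cost_deriv_eq[OF k] inner_add_left)
    show ?thesis
      unfolding stage_term_def 1 2 3 stage_form_def by (simp add: add_divide_distrib diff_divide_distrib)
  qed
  have final: "t1 (X (hor pb)) (a (hor pb)) + t2 (X (hor pb)) (p (hor pb)) (a (hor pb)) + ?mc (hor pb)
      = (lx pb X U (hor pb) + (hess (tcost pb) (X (hor pb)) + meas_curv pb X (hor pb)) *v p (hor pb)) \<bullet> a (hor pb)"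
    by (simp add: tcost_deriv_eq inner_add_left matrix_vector_mult_add_rdistrib inner_hess[OF tcost_deriv])
  have prior: "a 0 \<bullet> (matrix_inv (pcov pb) *v p 0) / mu pb
      + a 0 \<bullet> (matrix_inv (pcov pb) *v (X 0 - xprior pb)) / mu pb
      = a 0 \<bullet> (matrix_inv (pcov pb) *v (p 0 + X 0 - xprior pb)) / mu pb"
    by (simp add: add_diff_eq[symmetric] matrix_vector_right_distrib inner_add_right add_divide_distrib)
  have "(\<Sum>j=1..cur pb. m1 j (X j) (a j) \<bullet> (matrix_inv (mcov pb j) *v \<gamma> pb X j)) / mu pb
      - (\<Sum>j=1..cur pb. m1 j (X j) (a j) \<bullet> (matrix_inv (mcov pb j) *v m1 j (X j) (p j))
        - m2 j (X j) (p j) (a j) \<bullet> (matrix_inv (mcov pb j) *v \<gamma> pb X j)) / mu pb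
      = (\<Sum>k<hor pb. ?mc k) + ?mc (hor pb) + (\<Sum>k<hor pb. ?mt (k + 1))"
    unfolding mt[symmetric] mc[symmetric] sum_divide_distrib sum_subtractf[symmetric] sum.distrib[symmetric]
    by (rule sum.cong) (simp_all only: meas add.commute)
  note this[unfolded sum_subtractf diff_divide_distrib]
  moreover note sum.cong[of "{..<hor pb}" _ "stage_term p q a b", OF refl stage, unfolded sum.distrib sum_subtractf sum_divide_distrib[symmetric] diff_divide_distrib]
  ultimately show ?thesis
    unfolding second_var_def first_var_def sum_subtractf diff_divide_distrib
    using final prior by linarith
qed

end

context ocp_pass begin

definition multiplier :: "nat \<Rightarrow> real^'n"
  where "multiplier k = (if k \<le> cur pb then (1 / mu pb) *\<^sub>R estate k else costate k)"

lemma multiplier_costate: "cur pb \<le> k \<Longrightarrow> multiplier k = costate k"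
  using mu_pos estate_cur by (auto simp: multiplier_def)

text \<open>Before the current time neither the step nor the variation moves the control, so only
  the state equation is tested. Afterwards stationarity in the control removes the
  \<open>b k\<close> terms, and the adjoint recursion leaves the difference.\<close>

lemma stage_telescope:
  assumes k: "k < hor pb"
    and p: "p k = dir_x pb X U k" "p (k + 1) = dir_x pb X U (k + 1)"
    and q: "q k = (if k < cur pb then 0 else dir_u pb X U k)"
    and b: "k < cur pb \<Longrightarrow> b k = 0"
  shows "stage_term p q a b k = multiplier k \<bullet> a k - multiplier (k + 1) \<bullet> a (k + 1)"
proof (cases "k < cur pb")
  case True
  let ?F = "fx pb X U k" and ?r = "matrix_inv (qcov pb (k + 1)) *v
    (dir_x pb X U (k + 1) + w pb X U (k + 1) - fx pb X U k *v dir_x pb X U k)"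
  have r: "matrix_inv (qcov pb (k + 1)) *v
      (w pb X U (k + 1) + p (k + 1) - fx pb X U k *v p k - fu pb X U k *v q k) = ?r"
    using True by (simp add: p[simplified] q algebra_simps)
  have mk: "multiplier k = lbar_xx pb X U k *v p k + lx pb X U k + (1 / mu pb) *\<^sub>R (transpose ?F *v ?r)"
    using True mu_pos by (simp add: multiplier_def est_step(1)[OF True] p[simplified] scaleR_right_distrib)
  have mk1: "multiplier (k + 1) = (1 / mu pb) *\<^sub>R ?r - meas_term p (k + 1)"
    using True mu_pos est_step(2)[OF True] by (simp add: multiplier_def meas_term_def p[simplified] scaleR_right_diff_distrib)
  show ?thesis
    unfolding stage_term_def r mk mk1
    using True by (simp add: q b inner_add_left inner_diff_left inner_diff_right inner_transpose_mult dot_lmul_matrix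
        diff_divide_distrib add_divide_distrib algebra_simps)
next
  case False
  then have t: "cur pb \<le> k" by simp
  have "matrix_inv (qcov pb (k + 1)) *v
      (w pb X U (k + 1) + p (k + 1) - fx pb X U k *v p k - fu pb X U k *v q k) = mu pb *\<^sub>R costate (k + 1)"
    unfolding p q using t
    by (simp add: ctl_step(1)[OF t k, simplified] matrix_vector_mult_scaleR
        matrix_inv_cancel_vector(1)[OF sym_posdef_invertible[OF qcov[OF k]], simplified])
  moreover have "lu pb X U k + lbar_ux pb X U k *v p k + lbar_uu pb X U k *v q k
      = - (transpose (fu pb X U k) *v costate (k + 1))"
    using ctl_step(2)[OF t k] t by (simp add: p q eq_neg_iff_add_eq_0)
  moreover have "lx pb X U k + lbar_xx pb X U k *v p k + lbar_xu pb X U k *v q k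
      = costate k - transpose (fx pb X U k) *v costate (k + 1)"
    using ctl_step(3)[OF t k] t by (simp add: p q)
  moreover have "meas_term p (k + 1) = 0" using t by (simp add: meas_term_def)
  moreover have "multiplier k = costate k" "multiplier (k + 1) = costate (k + 1)"
    using t by (simp_all add: multiplier_costate)
  ultimately show ?thesis
    unfolding stage_term_def using mu_pos
    by (simp add: inner_diff_left inner_diff_right dot_lmul_matrix diff_divide_distrib)
qed

text \<open>The two ends of the telescoping sum cancel against the boundary terms because of the
  starting values of the passes: the terminal values of \<open>Vmat\<close> and \<open>vvec\<close>,
  and \<open>Pest 0\<close>, \<open>muhat 0\<close> for the prior.\<close>

lemma newton_stationarity:
  assumes p: "\<And>k. k \<le> hor pb \<Longrightarrow> p k = dir_x pb X U k"
    and q: "\<And>k. k < hor pb \<Longrightarrow> q k = (if k < cur pb then 0 else dir_u pb X U k)"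
    and b: "\<And>k. k < cur pb \<Longrightarrow> b k = 0"
  shows "second_var p q a b + first_var a b = 0"
proof -
  have "(\<Sum>k<hor pb. stage_term p q a b k) = (\<Sum>k<hor pb. multiplier k \<bullet> a k - multiplier (Suc k) \<bullet> a (Suc k))"
    using p q b by (intro sum.cong refl) (simp add: stage_telescope)
  then have 1: "(\<Sum>k<hor pb. stage_term p q a b k) = multiplier 0 \<bullet> a 0 - multiplier (hor pb) \<bullet> a (hor pb)"
    using sum_lessThan_telescope'[of "\<lambda>k. multiplier k \<bullet> a k"] by simp
  have 2: "lx pb X U (hor pb) + (hess (tcost pb) (X (hor pb)) + meas_curv pb X (hor pb)) *v p (hor pb)
      = multiplier (hor pb)"
    using cur_le_hor by (simp add: multiplier_costate costate_def p Vmat.simps vvec.simps)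
  have "multiplier 0 = (1 / mu pb) *\<^sub>R (matrix_inv (pcov pb) *v (p 0 + X 0 - xprior pb))"
    by (simp add: multiplier_def estate_def p algebra_simps)
  then have 3: "multiplier 0 \<bullet> a 0 = a 0 \<bullet> (matrix_inv (pcov pb) *v (p 0 + X 0 - xprior pb)) / mu pb"
    by (simp add: inner_commute)
  show ?thesis unfolding variation_eq_stage_sum 1 2 3 by simp
qed

end

section \<open>Stacked variables\<close>

text \<open>Beyond the horizon \<open>state\<close> and \<open>ctrl\<close> read arbitrary
  coordinates, because \<open>e\<close> is controlled only on \<open>var_idx pb\<close>; the
  objective does not see them.\<close>

lemma Jtraj_cong:
  assumes "\<And>k. k \<le> hor pb \<Longrightarrow> X k = X' k" and "\<And>k. k < hor pb \<Longrightarrow> U k = U' k" and "cur pb \<le> hor pb"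
  shows "Jtraj pb X U = Jtraj pb X' U'"
  unfolding Jtraj_def using assms by simp

locale ocp_coords = ocp_twice pb c1 c2 d1 d2 m1 m2 t1 t2
  for pb :: "('n::finite, 'm::finite, 'q::finite) ocp" and c1 c2 d1 d2 m1 m2 t1 t2 +
  fixes e :: "nat \<times> 'n + nat \<times> 'm \<Rightarrow> 'N::finite"
  assumes coords: "bij_betw e (var_idx pb) UNIV"
begin

text \<open>The linear part of \<open>ctrl\<close>, which is affine because the past controls are
  constants.\<close>

definition dctrl :: "real^'N \<Rightarrow> nat \<Rightarrow> real^'m"
  where "dctrl v k = (if k < cur pb then 0 else (\<chi> i. v $ e (Inr (k, i))))"

sublocale traj: ocp_iterate pb c1 c2 d1 d2 m1 m2 t1 t2 "state e z" "ctrl pb e z" for z :: "real^'N"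
  by unfold_locales

lemma bounded_linear_state: "bounded_linear (\<lambda>v. state e v k)"
  unfolding linear_conv_bounded_linear[symmetric]
  by (rule linearI) (simp_all add: state_def vec_eq_iff)

lemma bounded_linear_dctrl: "bounded_linear (\<lambda>v. dctrl v k)"
  unfolding linear_conv_bounded_linear[symmetric]
  by (rule linearI) (simp_all add: dctrl_def vec_eq_iff)

lemma state_add: "state e (z + v) k = state e z k + state e v k"
  by (simp add: state_def vec_eq_iff)

lemma ctrl_add: "ctrl pb e (z + v) k = ctrl pb e z k + dctrl v k"
  by (simp add: ctrl_def dctrl_def vec_eq_iff)

lemma ctrl_has_derivative: "((\<lambda>z. ctrl pb e z k) has_derivative (\<lambda>v. dctrl v k)) (at z)"
proof -
  have *: "((\<lambda>z. ctrl pb e 0 k + dctrl z k) has_derivative (\<lambda>v. 0 + dctrl v k)) (at z)"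
    by (intro has_derivative_add has_derivative_const bounded_linear_imp_has_derivative bounded_linear_dctrl)
  have eq: "(\<lambda>z. ctrl pb e z k) = (\<lambda>z. ctrl pb e 0 k + dctrl z k)"
    by (rule ext) (simp add: ctrl_add[of 0 _ k, simplified, symmetric])
  show ?thesis by (subst eq) (use * in simp)
qed

lemma stage_has_derivative:
  "((\<lambda>z. (state e z k, ctrl pb e z k)) has_derivative (\<lambda>v. (state e v k, dctrl v k))) (at z)"
  by (intro has_derivative_Pair bounded_linear_imp_has_derivative bounded_linear_state ctrl_has_derivative)

lemma J_twice_deriv:
  "twice_deriv (J pb e) (\<lambda>z v. traj.first_var z (state e v) (dctrl v))
    (\<lambda>z u v. traj.second_var z (state e u) (dctrl u) (state e v) (dctrl v))"
proof -
  note st = bounded_linear_imp_has_derivative[OF bounded_linear_state]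
  have cost: "twice_deriv (\<lambda>z. cost pb k (state e z k, ctrl pb e z k))
      (\<lambda>z v. c1 k (state e z k, ctrl pb e z k) (state e v k, dctrl v k))
      (\<lambda>z u v. c2 k (state e z k, ctrl pb e z k) (state e u k, dctrl u k) (state e v k, dctrl v k))"
    if "k \<in> {..<hor pb}" for k
    by (rule twice_deriv_affine[OF cost_deriv stage_has_derivative]) (use that in simp)
  have dyn: "twice_deriv (\<lambda>z. dyn pb k (state e z k, ctrl pb e z k))
      (\<lambda>z v. d1 k (state e z k, ctrl pb e z k) (state e v k, dctrl v k))
      (\<lambda>z u v. d2 k (state e z k, ctrl pb e z k) (state e u k, dctrl u k) (state e v k, dctrl v k))"
    if "k \<in> {..<hor pb}" for k
    by (rule twice_deriv_affine[OF dyn_deriv stage_has_derivative]) (use that in simp)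
  have meas: "twice_deriv (\<lambda>z. meas pb k (state e z k)) (\<lambda>z v. m1 k (state e z k) (state e v k))
      (\<lambda>z u v. m2 k (state e z k) (state e u k) (state e v k))" if "k \<in> {1..cur pb}" for k
    by (rule twice_deriv_affine[OF meas_deriv st]) (use that in simp_all)
  have inv: "transpose (matrix_inv (pcov pb)) = matrix_inv (pcov pb)"
    "k \<in> {..<hor pb} \<Longrightarrow> transpose (matrix_inv (qcov pb (k + 1))) = matrix_inv (qcov pb (k + 1))"
    "k \<in> {1..cur pb} \<Longrightarrow> transpose (matrix_inv (mcov pb k)) = matrix_inv (mcov pb k)" for k
    by (auto intro!: sym_posdef_inv pcov mcov qcov[simplified])
  have prior: "twice_deriv (\<lambda>z. 1 / (2 * mu pb) * ((state e z 0 - xprior pb) \<bullet> (matrix_inv (pcov pb) *v (state e z 0 - xprior pb))))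
      (\<lambda>z v. state e v 0 \<bullet> (matrix_inv (pcov pb) *v (state e z 0 - xprior pb)) / mu pb)
      (\<lambda>z u v. state e v 0 \<bullet> (matrix_inv (pcov pb) *v state e u 0) / mu pb)"
    by (rule twice_deriv_cong, rule twice_deriv_cmult, rule twice_deriv_quadratic_form, rule twice_deriv_diff,
        rule twice_deriv_bounded_linear[OF bounded_linear_state], rule twice_deriv_const, rule inv(1), rule refl)
      simp_all
  \<comment> \<open>The factor 2 from differentiating each quadratic form cancels against
    \<open>1 / (2 * mu pb)\<close>.\<close>
  have half: "1 / (2 * mu pb) * (\<Sum>k\<in>A. 2 * f k) = (\<Sum>k\<in>A. f k) / mu pb" for A and f :: "nat \<Rightarrow> real"
    unfolding sum_distrib_left[symmetric] by simp
  have half2: "1 / (2 * mu pb) * (\<Sum>k\<in>A. 2 * f k + 2 * g k) = (\<Sum>k\<in>A. f k + g k) / mu pb" for A and f g :: "nat \<Rightarrow> real"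
    using half[of "\<lambda>k. f k + g k"] unfolding distrib_left .
  \<comment> \<open>The terms \<open>0 -\<close> are the derivatives of the constant measurements,
    kept so that the rules apply literally; they are simplified in the final assembly.\<close>
  have out: "twice_deriv (\<lambda>z. 1 / (2 * mu pb) * (\<Sum>j=1..cur pb. (yobs pb j - meas pb j (state e z j)) \<bullet>
          (matrix_inv (mcov pb j) *v (yobs pb j - meas pb j (state e z j)))))
      (\<lambda>z v. (\<Sum>j=1..cur pb. (0 - m1 j (state e z j) (state e v j)) \<bullet>
          (matrix_inv (mcov pb j) *v (yobs pb j - meas pb j (state e z j)))) / mu pb)
      (\<lambda>z u v. (\<Sum>j=1..cur pb. (0 - m1 j (state e z j) (state e v j)) \<bullet>
          (matrix_inv (mcov pb j) *v (0 - m1 j (state e z j) (state e u j)))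
        + (0 - m2 j (state e z j) (state e u j) (state e v j)) \<bullet>
          (matrix_inv (mcov pb j) *v (yobs pb j - meas pb j (state e z j)))) / mu pb)"
    by (rule twice_deriv_cong, rule twice_deriv_cmult, rule twice_deriv_sum, rule twice_deriv_quadratic_form,
        rule twice_deriv_diff, rule twice_deriv_const, erule meas, erule inv(3), rule refl) (rule half half2)+
  have trans: "twice_deriv (\<lambda>z. 1 / (2 * mu pb) * (\<Sum>k<hor pb. (state e z (k + 1) - dyn pb k (state e z k, ctrl pb e z k)) \<bullet>
          (matrix_inv (qcov pb (k + 1)) *v (state e z (k + 1) - dyn pb k (state e z k, ctrl pb e z k)))))
      (\<lambda>z v. (\<Sum>k<hor pb. (state e v (k + 1) - d1 k (state e z k, ctrl pb e z k) (state e v k, dctrl v k)) \<bullet>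
          (matrix_inv (qcov pb (k + 1)) *v (state e z (k + 1) - dyn pb k (state e z k, ctrl pb e z k)))) / mu pb)
      (\<lambda>z u v. (\<Sum>k<hor pb. (state e v (k + 1) - d1 k (state e z k, ctrl pb e z k) (state e v k, dctrl v k)) \<bullet>
          (matrix_inv (qcov pb (k + 1)) *v (state e u (k + 1) - d1 k (state e z k, ctrl pb e z k) (state e u k, dctrl u k)))
        + (0 - d2 k (state e z k, ctrl pb e z k) (state e u k, dctrl u k) (state e v k, dctrl v k)) \<bullet>
          (matrix_inv (qcov pb (k + 1)) *v (state e z (k + 1) - dyn pb k (state e z k, ctrl pb e z k)))) / mu pb)"
    by (rule twice_deriv_cong, rule twice_deriv_cmult, rule twice_deriv_sum, rule twice_deriv_quadratic_form,
        rule twice_deriv_diff, rule twice_deriv_bounded_linear[OF bounded_linear_state], erule dyn, erule inv(2), rule refl)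
      (rule half half2)+
  show ?thesis
    by (rule twice_deriv_cong[OF twice_deriv_diff[OF twice_deriv_diff[OF twice_deriv_diff[OF
          twice_deriv_add[OF twice_deriv_sum[OF cost] twice_deriv_affine[OF tcost_deriv st]] prior] out] trans]])
      (simp_all add: J_def Jtraj_def traj.first_var_def traj.second_var_def w_def \<gamma>_def sum_negf
        matrix_vector_mult_minus_right
        sum.distrib sum_subtractf)
qed

lemma grad_J_inner: "grad (J pb e) z \<bullet> v = traj.first_var z (state e v) (dctrl v)"
  by (rule inner_grad[OF twice_derivD(1)[OF J_twice_deriv]])

lemma hess_J_inner:
  "(hess (J pb e) z *v u) \<bullet> v = traj.second_var z (state e u) (dctrl u) (state e v) (dctrl v)"
  by (rule inner_hess[OF J_twice_deriv])

lemma in_var_idx: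
  "Inl (k, i) \<in> var_idx pb \<longleftrightarrow> k \<le> hor pb" "Inr (k, l) \<in> var_idx pb \<longleftrightarrow> cur pb \<le> k \<and> k < hor pb"
  by (auto simp: var_idx_def)

lemma stack_component:
  assumes "i \<in> var_idx pb"
  shows "stack pb e A B $ e i = (case i of Inl (k, i) \<Rightarrow> A k $ i | Inr (k, i) \<Rightarrow> B k $ i)"
  using bij_betw_inv_into_left[OF coords assms] by (simp add: stack_def)

lemma state_stack: "k \<le> hor pb \<Longrightarrow> state e (stack pb e A B) k = A k"
  by (simp add: state_def vec_eq_iff stack_component in_var_idx)

lemma dctrl_stack: "k < hor pb \<Longrightarrow> dctrl (stack pb e A B) k = (if k < cur pb then 0 else B k)"
  by (simp add: dctrl_def vec_eq_iff stack_component in_var_idx)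

lemma newton_direction:
  assumes "alg_well_defined pb e z"
  shows "hess (J pb e) z *v alg_dir pb e z = - grad (J pb e) z"
proof -
  interpret ocp_pass pb c1 c2 d1 d2 m1 m2 t1 t2 "state e z" "ctrl pb e z"
    using assms by unfold_locales (simp add: alg_well_defined_def)
  have "(hess (J pb e) z *v alg_dir pb e z + grad (J pb e) z) \<bullet> v = 0" for v
    unfolding inner_add_left grad_J_inner hess_J_inner
    by (rule newton_stationarity) (simp_all add: alg_dir_def state_stack dctrl_stack, simp add: dctrl_def)
  then have "hess (J pb e) z *v alg_dir pb e z + grad (J pb e) z = 0"
    by (metis inner_eq_zero_iff)
  then show ?thesis by (simp add: eq_neg_iff_add_eq_0)
qed

section \<open>Block gradients and the merit function\<close>

lemma sum_coords:
  fixes h :: "'N \<Rightarrow> real"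
  shows "(\<Sum>c\<in>UNIV. h c) = (\<Sum>k\<le>hor pb. \<Sum>i\<in>UNIV. h (e (Inl (k, i)))) + (\<Sum>k\<in>{cur pb..<hor pb}. \<Sum>i\<in>UNIV. h (e (Inr (k, i))))"
proof -
  have "(\<Sum>c\<in>UNIV. h c) = (\<Sum>i\<in>var_idx pb. h (e i))"
    by (rule sum.reindex_bij_betw[OF coords, symmetric])
  also have "\<dots> = (\<Sum>i\<in>{..hor pb} \<times> UNIV. h (e (Inl i))) + (\<Sum>i\<in>{cur pb..<hor pb} \<times> UNIV. h (e (Inr i)))"
    unfolding var_idx_def by (subst sum.Plus) (simp_all add: comp_def)
  finally show ?thesis by (simp add: sum.cartesian_product)
qed

lemma inner_coords:
  "v \<bullet> y = (\<Sum>k\<le>hor pb. state e v k \<bullet> state e y k) + (\<Sum>k\<in>{cur pb..<hor pb}. dctrl v k \<bullet> dctrl y k)"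
  unfolding inner_vec_def[of v y] sum_coords by (simp add: inner_vec_def state_def dctrl_def)

lemma J_perturb:
  "J pb e (z + stack pb e A B) =
    Jtraj pb (\<lambda>k. state e z k + A k) (\<lambda>k. ctrl pb e z k + (if k < cur pb then 0 else B k))"
  unfolding J_def
  by (rule Jtraj_cong) (simp_all add: state_add ctrl_add state_stack dctrl_stack cur_le_hor)

text \<open>The merit function differentiates in trajectory space, one block at a time. Varying a
  block is moving the stacked vector along a linear embedding \<open>B\<close>, so each block
  gradient is read off from the full one.\<close>

lemma grad_along:
  assumes lin: "linear B" and F: "\<And>\<xi>. F \<xi> = J pb e (z + B (\<xi> - \<xi>0))"
  shows "grad F (\<xi>0 :: 'a::euclidean_space) \<bullet> a = grad (J pb e) z \<bullet> B a"
proof -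
  have bl: "bounded_linear B" using lin by (simp add: linear_conv_bounded_linear)
  have "((\<lambda>\<xi>. \<xi> - \<xi>0) has_derivative (\<lambda>h. h)) (at \<xi>0)"
    by (auto intro!: derivative_eq_intros)
  then have "((\<lambda>\<xi>. z + B (\<xi> - \<xi>0)) has_derivative (\<lambda>h. 0 + B h)) (at \<xi>0)"
    by (intro has_derivative_add has_derivative_const bounded_linear.has_derivative[OF bl])
  then have "((\<lambda>\<xi>. J pb e (z + B (\<xi> - \<xi>0))) has_derivative
      (\<lambda>h. traj.first_var (z + B (\<xi>0 - \<xi>0)) (state e (0 + B h)) (dctrl (0 + B h)))) (at \<xi>0)"
    by (rule has_derivative_compose[OF _ twice_derivD(1)[OF J_twice_deriv]])
  moreover have "F = (\<lambda>\<xi>. J pb e (z + B (\<xi> - \<xi>0)))" using F by blast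
  ultimately show ?thesis
    by (simp add: inner_grad grad_J_inner linear_0[OF lin])
qed

lemma partial_grad_state:
  assumes j: "j \<le> hor pb"
  shows "grad (\<lambda>\<xi>. Jtraj pb ((state e z)(j := \<xi>)) (ctrl pb e z)) (state e z j) = state e (grad (J pb e) z) j"
proof -
  let ?B = "\<lambda>a. stack pb e ((\<lambda>_. 0)(j := a)) (\<lambda>_. 0)"
  have "linear ?B"
    by (rule linearI) (simp_all add: stack_def vec_eq_iff split: sum.split prod.split)
  moreover have "Jtraj pb ((state e z)(j := \<xi>)) (ctrl pb e z) = J pb e (z + ?B (\<xi> - state e z j))" for \<xi>
    unfolding J_perturb by (rule Jtraj_cong) (simp_all add: cur_le_hor)
  ultimately have "grad (\<lambda>\<xi>. Jtraj pb ((state e z)(j := \<xi>)) (ctrl pb e z)) (state e z j) \<bullet> a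
      = state e (grad (J pb e) z) j \<bullet> a" for a
  proof (subst grad_along[of ?B])
    have "(\<Sum>k\<le>hor pb. state e (grad (J pb e) z) k \<bullet> state e (?B a) k)
        = (\<Sum>k\<le>hor pb. if k = j then state e (grad (J pb e) z) j \<bullet> a else 0)"
      by (rule sum.cong) (simp_all add: state_stack)
    then show "grad (J pb e) z \<bullet> ?B a = state e (grad (J pb e) z) j \<bullet> a"
      using j by (simp add: inner_coords dctrl_stack)
  qed
  then show ?thesis using vector_eq_rdot by blast
qed

lemma partial_grad_ctrl:
  assumes j: "cur pb \<le> j" "j < hor pb"
  shows "grad (\<lambda>\<nu>. Jtraj pb (state e z) ((ctrl pb e z)(j := \<nu>))) (ctrl pb e z j) = dctrl (grad (J pb e) z) j"
proof -
  let ?B = "\<lambda>a. stack pb e (\<lambda>_. 0) ((\<lambda>_. 0)(j := a))"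
  have "linear ?B"
    by (rule linearI) (simp_all add: stack_def vec_eq_iff split: sum.split prod.split)
  moreover have "Jtraj pb (state e z) ((ctrl pb e z)(j := \<nu>)) = J pb e (z + ?B (\<nu> - ctrl pb e z j))" for \<nu>
    unfolding J_perturb using j by (intro Jtraj_cong) (auto simp: cur_le_hor)
  ultimately have "grad (\<lambda>\<nu>. Jtraj pb (state e z) ((ctrl pb e z)(j := \<nu>))) (ctrl pb e z j) \<bullet> a
      = dctrl (grad (J pb e) z) j \<bullet> a" for a
  proof (subst grad_along[of ?B])
    have "(\<Sum>k\<in>{cur pb..<hor pb}. dctrl (grad (J pb e) z) k \<bullet> dctrl (?B a) k)
        = (\<Sum>k\<in>{cur pb..<hor pb}. if k = j then dctrl (grad (J pb e) z) j \<bullet> a else 0)"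
      by (rule sum.cong) (simp_all add: dctrl_stack)
    then show "grad (J pb e) z \<bullet> ?B a = dctrl (grad (J pb e) z) j \<bullet> a"
      using j by (simp add: inner_coords state_stack)
  qed
  then show ?thesis using vector_eq_rdot by blast
qed

lemma merit_eq: "merit pb e z = 1/2 * (norm (grad (J pb e) z))\<^sup>2"
  unfolding merit_def Let_def power2_norm_eq_inner inner_coords[of "grad (J pb e) z"]
  by (simp add: partial_grad_state partial_grad_ctrl)

lemma grad_merit: "grad (merit pb e) z \<bullet> v = grad (J pb e) z \<bullet> (hess (J pb e) z *v v)"
proof -
  note D = grad_has_derivative_hess[OF J_twice_deriv]
  have "((\<lambda>z. 1/2 * (grad (J pb e) z \<bullet> grad (J pb e) z)) has_derivative
      (\<lambda>v. 1/2 * (grad (J pb e) z \<bullet> (hess (J pb e) z *v v) + (hess (J pb e) z *v v) \<bullet> grad (J pb e) z))) (at z)"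
    by (intro has_derivative_mult_right has_derivative_inner D)
  moreover have "merit pb e = (\<lambda>z. 1/2 * (grad (J pb e) z \<bullet> grad (J pb e) z))"
    by (rule ext) (simp add: merit_eq power2_norm_eq_inner)
  ultimately have "(merit pb e has_derivative (\<lambda>v. grad (J pb e) z \<bullet> (hess (J pb e) z *v v))) (at z)"
    by (simp add: inner_commute)
  then show ?thesis by (rule inner_grad)
qed

lemma wolfe_merit:
  assumes "hess (J pb e) z *v p = - grad (J pb e) z"
  shows "wolfe a b (merit pb e) z p s \<longleftrightarrow>
    (norm (grad (J pb e) (z + s *\<^sub>R p)))\<^sup>2 \<le> (norm (grad (J pb e) z))\<^sup>2 - 2 * a * s * (norm (grad (J pb e) z))\<^sup>2 \<and>
    grad (J pb e) (z + s *\<^sub>R p) \<bullet> (hess (J pb e) (z + s *\<^sub>R p) *v p) \<ge> - b * (norm (grad (J pb e) z))\<^sup>2"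
proof -
  have "grad (merit pb e) z \<bullet> p = - (norm (grad (J pb e) z))\<^sup>2"
    by (simp add: grad_merit assms power2_norm_eq_inner)
  then show ?thesis unfolding wolfe_def grad_merit[of "z + s *\<^sub>R p"] merit_eq by auto
qed

end

section \<open>From the control problem to the damped Newton iteration\<close>

lemma ocp_twiceE:
  assumes "ocp_setting pb"
  obtains c1 c2 d1 d2 m1 m2 t1 t2 where "ocp_twice pb c1 c2 d1 d2 m1 m2 t1 t2"
proof -
  have "\<forall>k. \<exists>f1 f2. k < hor pb \<longrightarrow> twice_deriv (cost pb k) f1 f2"
    using assms C2_imp_twice_deriv unfolding ocp_setting_def by metis
  then obtain c1 c2 where c: "\<And>k. k < hor pb \<Longrightarrow> twice_deriv (cost pb k) (c1 k) (c2 k)" by metis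
  have "\<forall>k. \<exists>f1 f2. k < hor pb \<longrightarrow> twice_deriv (dyn pb k) f1 f2"
    using assms C2_imp_twice_deriv unfolding ocp_setting_def by metis
  then obtain d1 d2 where d: "\<And>k. k < hor pb \<Longrightarrow> twice_deriv (dyn pb k) (d1 k) (d2 k)" by metis
  have "\<forall>k. \<exists>f1 f2. 1 \<le> k \<and> k \<le> cur pb \<longrightarrow> twice_deriv (meas pb k) f1 f2"
    using assms C2_imp_twice_deriv unfolding ocp_setting_def by (metis atLeastAtMost_iff)
  then obtain m1 m2 where m: "\<And>k. 1 \<le> k \<Longrightarrow> k \<le> cur pb \<Longrightarrow> twice_deriv (meas pb k) (m1 k) (m2 k)" by metis
  obtain t1 t2 where "twice_deriv (tcost pb) t1 t2"
    using assms C2_imp_twice_deriv unfolding ocp_setting_def by metis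
  then have "ocp_twice pb c1 c2 d1 d2 m1 m2 t1 t2"
    using assms c d m by unfold_locales auto
  then show ?thesis by (rule that)
qed

text \<open>A step of length \<alpha> multiplies the error near the limit by about
  \<open>|1 - \<alpha>|\<close>, and the Wolfe conditions alone do not force
  \<open>\<alpha> = 1\<close>. The rate is therefore stated for unit steps, and for all steps if the
  unit step is eventually taken whenever admissible. Then \<open>c1 < 1/2\<close> matters: a full
  Newton step removes at most the whole merit \<open>|g|^2 / 2\<close>, while the decrease condition
  asks for \<open>c1 * |g|^2\<close>.\<close>

theorem proposition4:
  fixes pb :: "('n::finite, 'm::finite, 'q::finite) ocp"
    and e :: "nat \<times> 'n + nat \<times> 'm \<Rightarrow> 'N::finite"
    and z :: "nat \<Rightarrow> real^'N"
    and \<alpha> :: "nat \<Rightarrow> real"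
    and c1 c2 :: real
  assumes setting: "ocp_setting pb"
    and coords: "bij_betw e (var_idx pb) UNIV"
    and wolfe_consts: "0 < c1" "c1 < c2" "c2 < 1"
    and hess_invertible: "\<And>\<zeta>. invertible (hess (J pb e) \<zeta>)"
    and hess_inv_bounded: "bounded (range (\<lambda>\<zeta>. matrix_inv (hess (J pb e) \<zeta>)))"
    and smooth: "\<exists>N. open N \<and> {\<zeta>. merit pb e \<zeta> \<le> merit pb e (z 0)} \<subseteq> N \<and>
        bounded (hess (J pb e) ` N) \<and> (\<exists>L. L-lipschitz_on N (hess (J pb e)))"
    and well_defined: "\<And>i. alg_well_defined pb e (z i)"
    and step: "\<And>i. z (Suc i) = z i + \<alpha> i *\<^sub>R alg_dir pb e (z i)"
    and step_pos: "\<And>i. 0 < \<alpha> i"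
    and step_wolfe: "\<And>i. wolfe c1 c2 (merit pb e) (z i) (alg_dir pb e (z i)) (\<alpha> i)"
  shows "\<exists>zs. z \<longlonglongrightarrow> zs \<and> grad (J pb e) zs = 0 \<and>
    (\<exists>C. \<exists>\<epsilon>>0. \<forall>i. norm (z i - zs) < \<epsilon> \<and> \<alpha> i = 1 \<longrightarrow>
        norm (z (Suc i) - zs) \<le> C * (norm (z i - zs))\<^sup>2) \<and>
    (c1 < 1/2 \<and>
     (\<forall>\<^sub>F i in sequentially.
        wolfe c1 c2 (merit pb e) (z i) (alg_dir pb e (z i)) 1 \<longrightarrow> \<alpha> i = 1) \<longrightarrow>
     (\<exists>C. \<exists>\<epsilon>>0. \<forall>i. norm (z i - zs) < \<epsilon> \<longrightarrow>
        norm (z (Suc i) - zs) \<le> C * (norm (z i - zs))\<^sup>2))"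
proof -
  obtain f1 f2 d1 d2 m1 m2 t1 t2 where "ocp_twice pb f1 f2 d1 d2 m1 m2 t1 t2"
    using setting by (rule ocp_twiceE)
  then interpret ocp_coords pb f1 f2 d1 d2 m1 m2 t1 t2 e
    using coords by (simp add: ocp_coords_def ocp_coords_axioms_def)
  obtain K where K: "\<And>\<zeta>. norm (matrix_inv (hess (J pb e) \<zeta>)) \<le> K"
    using hess_inv_bounded by (auto simp: bounded_iff)
  obtain N L where N: "open N" "{\<zeta>. merit pb e \<zeta> \<le> merit pb e (z 0)} \<subseteq> N" "L-lipschitz_on N (hess (J pb e))"
    using smooth by blast
  have newton: "hess (J pb e) (z i) *v alg_dir pb e (z i) = - grad (J pb e) (z i)" for i
    by (rule newton_direction[OF well_defined])
  have wolfe_step: "(norm (grad (J pb e) (z (Suc i))))\<^sup>2 \<le>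
        (norm (grad (J pb e) (z i)))\<^sup>2 - 2 * c1 * \<alpha> i * (norm (grad (J pb e) (z i)))\<^sup>2 \<and>
      - c2 * (norm (grad (J pb e) (z i)))\<^sup>2
        \<le> grad (J pb e) (z (Suc i)) \<bullet> (hess (J pb e) (z (Suc i)) *v alg_dir pb e (z i))" for i
    using step_wolfe[of i] unfolding wolfe_merit[OF newton] step .
  interpret newton: newton_wolfe "grad (J pb e)" "hess (J pb e)" K c1 c2 z "\<lambda>i. alg_dir pb e (z i)" \<alpha> N L
  proof
    show "{x. norm (grad (J pb e) x) \<le> norm (grad (J pb e) (z 0))} \<subseteq> N"
      using N(2) unfolding merit_eq by (auto intro: power_mono)
  qed (use grad_has_derivative_hess[OF J_twice_deriv] hess_invertible K wolfe_consts newton step step_pos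
      wolfe_step N in \<open>auto simp del: minus_mult_left\<close>)
  have "\<exists>C. \<exists>\<epsilon>>0. \<forall>i. norm (z i - newton.zs) < \<epsilon> \<longrightarrow>
      norm (z (Suc i) - newton.zs) \<le> C * (norm (z i - newton.zs))\<^sup>2"
    if "c1 < 1/2" and unit: "\<forall>\<^sub>F i in sequentially.
        wolfe c1 c2 (merit pb e) (z i) (alg_dir pb e (z i)) 1 \<longrightarrow> \<alpha> i = 1"
  proof (rule newton.quadratic_eventually_unit)
    show "\<forall>\<^sub>F i in sequentially. \<alpha> i = 1"
      using newton.unit_step_accepted[OF that(1)] unit
      by eventually_elim (simp add: wolfe_merit[OF newton])
  qed
  then show ?thesis
    using newton.lim_z newton.stationary newton.quadratic_unit_steps by blast
qed

end
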